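(* Let $P=\{\mathbf{x}\in\mathbb{R}^d:\mathbf{A}\mathbf{x}\le\mathbf{b}\}$ be a rational $d$-polytope with codenominator $r$ and $\mathbf{0}\in P$, where the description is irredundant, $\mathbf{A}\in\mathbb{Z}^{n\times d}$ has rows $\mathbf{a}_1,\dots,\mathbf{a}_n$, $\mathbf{b}\in\mathbb{Z}^n$, the greatest common divisor of $b_j$ and the entries of $\mathbf{a}_j$ is $1$ for every $j$, and the rows are ordered so that, for some index $0\le i\le n$, $b_j=0$ for $j=1,\dots,i$ and $b_j\ne0$ for $j=i+1,\dots,n$. Let $g,m\in\mathbb{Z}_{\ge1}$ with $\frac mrP$ a lattice polytope. Then the following are equivalent: (i) $P$ is $r$-rational Gorenstein with Gorenstein point $(g,\mathbf{y})\in\hom(\frac1rP)$ for some $\mathbf{y}\in\mathbb{Z}^d$. (ii) There exists a (necessarily unique) integer solution $(g,\mathbf{y})$, $\mathbf{y}\in\mathbb{Z}^d$, to $$-\langle\mathbf{a}_j,\mathbf{y}\rangle=1\ \text{ for }j=1,\dots,i,\qquad b_j\,g-r\,\langle\mathbf{a}_j,\mathbf{y}\rangle=b_j\ \text{ for }j=i+1,\dots,n.$$ (iii) $\operatorname{h}^*_{\mathbb{Q}}(P;t;m)$ is palindromic in the sense that $$t^{(d+1)\frac mr-\frac gr}\,\operatorname{h}^*_{\mathbb{Q}}\left(P;\tfrac1t;m\right)=\operatorname{h}^*_{\mathbb{Q}}(P;t;m).$$ (iv) $(-1)^{d+1}t^{\frac gr}\operatorname{Ehr}_{\mathbb{Q}}(P;t)=\operatorname{Ehr}_{\mathbb{Q}}(P;\frac1t)$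 as rational functions in $t^{1/r}$. (v) $\operatorname{ehr}_{\mathbb{Q}}(P;\frac nr)=\operatorname{ehr}_{\mathbb{Q}}(P^\circ;\frac{n+g}{r})$ for all $n\in\mathbb{Z}_{\ge0}$. (vi) $\hom(\frac1rP)^\vee$ is the cone over a lattice polytope, i.e., there exists a lattice point $(g,\mathbf{y})\in\hom(\frac1rP)^\circ\cap\mathbb{Z}^{d+1}$ such that for every primitive ray generator $(v_0,\mathbf{v})$ of $\hom(\frac1rP)^\vee$ one has $\langle(g,\mathbf{y}),(v_0,\mathbf{v})\rangle=1$.
   Context: A rational (resp. lattice) polytope is the convex hull of finitely many points of $\mathbb{Q}^d$ (resp. $\mathbb{Z}^d$); a $d$-polytope is a $d$-dimensional polytope in $\mathbb{R}^d$, $d\ge1$. With the description $\mathbf{A}\mathbf{x}\le\mathbf{b}$ as in the statement, the codenominator of $P$ is the (positive) least common multiple $r$ of the nonzero entries of $\mathbf{b}$. For rational $\lambda\ge0$, $\operatorname{ehr}_{\mathbb{Q}}(P;\lambda)=|\lambda P\cap\mathbb{Z}^d|$; for the interior $P^\circ$ and $\lambda>0$, $\operatorname{ehr}_{\mathbb{Q}}(P^\circ;\lambda)=|\lambda P^\circ\cap\mathbb{Z}^d|$. The rational Ehrhart series is $\operatorname{Ehr}_{\mathbb{Q}}(P;t)=1+\sum_{n\in\mathbb{Z}_{>0}}\operatorname{ehr}_{\mathbb{Q}}(P;\frac nr)t^{\frac nr}$. For $m\in\mathbb{Z}_{>0}$ with $\frac mrP$ a lattice polytope, $\operatorname{h}^*_{\mathbb{Q}}(P;t;m):=(1-t^{m/r})^{d+1}\operatorname{Ehr}_{\mathbb{Q}}(P;t)$,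 which is a polynomial in $\mathbb{Z}[t^{1/r}]$; thus $\operatorname{Ehr}_{\mathbb{Q}}(P;t)$ is a rational function in $t^{1/r}$. For a rational polytope $Q\subset\mathbb{R}^d$, $\hom(Q)=\operatorname{cone}(\{1\}\times Q)\subset\mathbb{R}^{d+1}$. The dual of a cone $C\subseteq\mathbb{R}^{d+1}$ is $C^\vee=\{(y_0,\mathbf{y})\in(\mathbb{R}^{d+1})^\vee:\langle(y_0,\mathbf{y}),(x_0,\mathbf{x})\rangle\ge0\text{ for all }(x_0,\mathbf{x})\in C\}$; $C^\circ$ is the interior of $C$. A $(d+1)$-dimensional pointed rational cone $C\subseteq\mathbb{R}^{d+1}$ is Gorenstein if there is a point $(p_0,\mathbf{p})\in C\cap\mathbb{Z}^{d+1}$ with $C^\circ\cap\mathbb{Z}^{d+1}=(p_0,\mathbf{p})+(C\cap\mathbb{Z}^{d+1})$; this point is called the Gorenstein point. A rational $d$-polytope $P$ is $\gamma$-rational Gorenstein (with Gorenstein point $(g,\mathbf{y})$) if $\hom(\frac1\gamma P)$ is a Gorenstein cone (with Gorenstein point $(g,\mathbf{y})$). A lattice point is primitive if the gcd of its coordinates is $1$. *)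

theory Defs
  imports
    "HOL-Analysis.Analysis"
    "HOL-Computational_Algebra.Computational_Algebra"
begin

section \<open>Lattice points, polytopes and cones\<close>

text \<open>The ambient space \<open>\<real>\<^sup>d\<close> is \<open>real ^ 'd\<close> with \<open>d = CARD('d)\<close>, and \<open>\<real> \<times> \<real>\<^sup>d\<close> (the height
  coordinate first) is \<open>real \<times> (real ^ 'd)\<close>. The following two sets are
  \<open>\<int>\<^sup>k\<close> and \<open>\<rat>\<^sup>k\<close> in either of these spaces.\<close>

definition lattice_points :: "'a::euclidean_space set" where
  "lattice_points = {x. \<forall>e\<in>Basis. x \<bullet> e \<in> \<int>}"

definition rational_points :: "'a::euclidean_space set" where
  "rational_points = {x. \<forall>e\<in>Basis. x \<bullet> e \<in> \<rat>}"

definition of_int_vec :: "int ^ 'd \<Rightarrow> real ^ 'd" where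
  "of_int_vec v = (\<chi> k. of_int (v $ k))"

definition primitive :: "'a::euclidean_space \<Rightarrow> bool" where
  "primitive x \<longleftrightarrow> x \<in> lattice_points \<and> Gcd ((\<lambda>e. \<lfloor>x \<bullet> e\<rfloor>) ` Basis) = 1"

definition lattice_polytope :: "'a::euclidean_space set \<Rightarrow> bool" where
  "lattice_polytope Q \<longleftrightarrow> (\<exists>V. finite V \<and> V \<subseteq> lattice_points \<and> Q = convex hull V)"

definition rational_polytope :: "'a::euclidean_space set \<Rightarrow> bool" where
  "rational_polytope Q \<longleftrightarrow> (\<exists>V. finite V \<and> V \<subseteq> rational_points \<and> Q = convex hull V)"

definition dilate :: "real \<Rightarrow> 'a::real_vector set \<Rightarrow> 'a set" where
  "dilate c S = (\<lambda>x. c *\<^sub>R x) ` S"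

definition homog_cone :: "(real ^ 'd) set \<Rightarrow> (real \<times> (real ^ 'd)) set" where
  "homog_cone Q = convex_cone hull ({1} \<times> Q)"

text \<open>The dual space is identified with the space itself through the inner product.\<close>

definition dual_cone :: "'a::real_inner set \<Rightarrow> 'a set" where
  "dual_cone C = {v. \<forall>x\<in>C. 0 \<le> v \<bullet> x}"

definition rational_cone :: "'a::euclidean_space set \<Rightarrow> bool" where
  "rational_cone C \<longleftrightarrow> (\<exists>V. finite V \<and> V \<subseteq> rational_points \<and> C = convex_cone hull V)"

definition pointed :: "'a::real_vector set \<Rightarrow> bool" where
  "pointed C \<longleftrightarrow> C \<inter> uminus ` C = {0}"

definition primitive_ray_generator :: "'a::euclidean_space set \<Rightarrow> 'a \<Rightarrow> bool" where
  "primitive_ray_generator C v \<longleftrightarrow> primitive v \<and> {c *\<^sub>R v | c. 0 \<le> c} face_of C"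

definition Gorenstein_cone_with_point :: "'a::euclidean_space set \<Rightarrow> 'a \<Rightarrow> bool" where
  "Gorenstein_cone_with_point C p \<longleftrightarrow>
     rational_cone C \<and> pointed C \<and> aff_dim C = int DIM('a) \<and>
     p \<in> C \<inter> lattice_points \<and>
     interior C \<inter> lattice_points = (\<lambda>x. p + x) ` (C \<inter> lattice_points)"

definition rational_Gorenstein :: "real \<Rightarrow> (real ^ 'd) set \<Rightarrow> real \<times> (real ^ 'd) \<Rightarrow> bool" where
  "rational_Gorenstein \<gamma> P p \<longleftrightarrow> Gorenstein_cone_with_point (homog_cone (dilate (1 / \<gamma>) P)) p"

definition codenominator :: "nat \<Rightarrow> (nat \<Rightarrow> int) \<Rightarrow> nat" where
  "codenominator n b = nat (Lcm (b ` {1..n} - {0}))"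


section \<open>Rational functions in one variable\<close>

text \<open>Throughout, the variable \<open>X\<close> of formal power series, polynomials and
  rational functions stands for \<open>t\<^bsup>1/r\<^esup>\<close>, so \<open>t\<^bsup>k/r\<^esup>\<close> is \<open>X ^ k\<close>, and
  substituting \<open>1/t\<close> for \<open>t\<close> is substituting \<open>1/X\<close> for \<open>X\<close>. The field of rational
  functions is the fraction field of \<open>\<int>[X]\<close>.\<close>

abbreviation ratfun_X :: "int poly fract" where
  "ratfun_X \<equiv> to_fract [:0, 1:]"

definition poly_at_recip :: "int poly \<Rightarrow> int poly fract" where
  "poly_at_recip p = poly (map_poly of_int p) (1 / ratfun_X)"

definition at_recip :: "int poly fract \<Rightarrow> int poly fract" where
  "at_recip f = poly_at_recip (fst (quot_of_fract f)) / poly_at_recip (snd (quot_of_fract f))"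

text \<open>The rational function whose power series expansion at \<open>0\<close> is \<open>F\<close>;
  meaningful only if there is one, see \<open>ratfun_of_fps_eqI\<close>.\<close>

definition ratfun_of_fps :: "int fps \<Rightarrow> int poly fract" where
  "ratfun_of_fps F =
     (THE f. \<exists>p q. q \<noteq> 0 \<and> fps_of_poly q * F = fps_of_poly p \<and> f = Fract p q)"

lemma ratfun_of_fps_eqI:
  assumes "q \<noteq> 0" and "fps_of_poly q * F = fps_of_poly p"
  shows "ratfun_of_fps F = Fract p q"
  unfolding ratfun_of_fps_def
proof (rule the_equality)
  show "\<exists>p' q'. q' \<noteq> 0 \<and> fps_of_poly q' * F = fps_of_poly p' \<and> Fract p q = Fract p' q'"
    using assms by blast
next
  fix f assume "\<exists>p' q'. q' \<noteq> 0 \<and> fps_of_poly q' * F = fps_of_poly p' \<and> f = Fract p' q'"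
  then obtain p' q' where *: "q' \<noteq> 0" "fps_of_poly q' * F = fps_of_poly p'" "f = Fract p' q'"
    by blast
  have "fps_of_poly (p' * q) = fps_of_poly (p * q')"
    by (simp add: fps_of_poly_mult mult_ac flip: assms(2) *(2))
  then show "f = Fract p q"
    using assms(1) * by (simp add: fps_of_poly_eq_iff eq_fract)
qed

lemma of_int_fract: "(of_int c :: int poly fract) = to_fract [:c:]"
proof -
  have nat: "(of_nat k :: int poly fract) = to_fract [:int k:]" for k
    by (induction k) (simp_all flip: to_fract_add to_fract_1 add: one_pCons)
  show ?thesis
    by (cases c rule: int_cases2) (simp_all add: nat flip: to_fract_uminus)
qed

lemma poly_at_recip_mult: "poly_at_recip (p * q) = poly_at_recip p * poly_at_recip q"
proof -
  have "map_poly of_int (p * q) = (map_poly of_int p * map_poly of_int q :: int poly fract poly)"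
    by (rule poly_eqI) (simp add: coeff_map_poly coeff_mult)
  then show ?thesis
    by (simp add: poly_at_recip_def)
qed

lemma poly_at_recip_eq_0_iff: "poly_at_recip p = 0 \<longleftrightarrow> p = 0"
proof
  assume z: "poly_at_recip p = 0"
  show "p = 0"
  proof (rule ccontr)
    assume nz: "p \<noteq> 0"
    have X0: "ratfun_X \<noteq> 0" by simp
    have deg: "degree (map_poly of_int p :: int poly fract poly) = degree p"
      by (rule degree_map_poly) (use nz in \<open>auto simp: of_int_fract\<close>)
    have pw: "to_fract (x ^ k) = to_fract x ^ k" for x :: "int poly" and k
      by (induction k) auto
    have sm: "to_fract (\<Sum>k\<in>A. g k) = (\<Sum>k\<in>A. to_fract (g k))" for g :: "nat \<Rightarrow> int poly" and A
      by (induction A rule: infinite_finite_induct) auto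
    have "0 = ratfun_X ^ degree p * poly_at_recip p"
      using z by simp
    also have "\<dots> = (\<Sum>k\<le>degree p. of_int (coeff p k) * ratfun_X ^ (degree p - k))"
      unfolding poly_at_recip_def poly_altdef deg sum_distrib_left
      by (rule sum.cong) (use X0 in \<open>auto simp: coeff_map_poly power_divide power_diff\<close>)
    also have "\<dots> = to_fract (\<Sum>k\<le>degree p. [:coeff p k:] * [:0, 1:] ^ (degree p - k))"
      by (simp only: sm of_int_fract to_fract_mult pw)
    finally have "(\<Sum>k\<le>degree p. [:coeff p k:] * [:0, 1:] ^ (degree p - k)) = 0"
      by (metis to_fract_eq_0_iff)
    then have "poly (\<Sum>k\<le>degree p. [:coeff p k:] * [:0, 1:] ^ (degree p - k)) 0 = 0"
      by simp
    then have "(\<Sum>k\<le>degree p. coeff p k * 0 ^ (degree p - k)) = 0"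
      by (simp add: poly_sum poly_power)
    moreover have "(\<Sum>k\<le>degree p. coeff p k * 0 ^ (degree p - k))
        = (\<Sum>k\<in>{degree p}. coeff p k)"
      by (rule sum.mono_neutral_cong_right) auto
    ultimately show False
      using nz by simp
  qed
qed (simp add: poly_at_recip_def)

lemma at_recip_Fract:
  assumes "q \<noteq> 0"
  shows "at_recip (Fract p q) = poly_at_recip p / poly_at_recip q"
proof -
  define u v where "u = fst (quot_of_fract (Fract p q))" and "v = snd (quot_of_fract (Fract p q))"
  have v: "v \<noteq> 0"
    by (simp add: v_def)
  have "Fract u v = Fract p q"
    using quot_to_fract_quot_of_fract[of "Fract p q"]
    by (simp add: quot_to_fract_def u_def v_def case_prod_unfold)
  then have "u * q = p * v"
    using assms v by (simp add: eq_fract)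
  then have "poly_at_recip u * poly_at_recip q = poly_at_recip p * poly_at_recip v"
    by (metis poly_at_recip_mult)
  then show ?thesis
    using assms v by (simp add: at_recip_def poly_at_recip_eq_0_iff frac_eq_eq flip: u_def v_def)
qed


section \<open>Rational Ehrhart theory\<close>

definition ehr :: "(real ^ 'd) set \<Rightarrow> real \<Rightarrow> nat" where
  "ehr S c = card (dilate c S \<inter> lattice_points)"

definition Ehr_fps :: "(real ^ 'd) set \<Rightarrow> nat \<Rightarrow> int fps" where
  "Ehr_fps P r = Abs_fps (\<lambda>k. if k = 0 then 1 else int (ehr P (real k / real r)))"

definition Ehr :: "(real ^ 'd) set \<Rightarrow> nat \<Rightarrow> int poly fract" where
  "Ehr P r = ratfun_of_fps (Ehr_fps P r)"

text \<open>The power series on the right-hand side is a polynomial whenever \<open>(m/r) P\<close> is a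
  lattice polytope.\<close>

definition hstar :: "(real ^ 'd) set \<Rightarrow> nat \<Rightarrow> nat \<Rightarrow> int poly" where
  "hstar P r m =
     (THE h. fps_of_poly h = (1 - fps_X ^ m) ^ (CARD('d) + 1) * Ehr_fps P r)"


definition facet_system_solution ::
    "(nat \<Rightarrow> int ^ 'd) \<Rightarrow> (nat \<Rightarrow> int) \<Rightarrow> nat \<Rightarrow> nat \<Rightarrow> nat \<Rightarrow> int \<Rightarrow> int ^ 'd \<Rightarrow> bool" where
  "facet_system_solution a b i n r g y \<longleftrightarrow>
     (\<forall>j\<in>{1..i}. - (\<Sum>k\<in>UNIV. a j $ k * y $ k) = 1) \<and>
     (\<forall>j\<in>{i+1..n}. b j * g - int r * (\<Sum>k\<in>UNIV. a j $ k * y $ k) = b j)"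


section \<open>Equivalence of a list of conditions\<close>

definition all_equivalent :: "bool list \<Rightarrow> bool" where
  "all_equivalent Ps \<longleftrightarrow> (\<forall>p\<in>set Ps. \<forall>q\<in>set Ps. p \<longleftrightarrow> q)"

end

theory Submission
  imports Defs
begin

text \<open>
  Let \<open>C = hom(1/r P)\<close>. Row \<open>j\<close> of \<open>A x \<le> b\<close> turns into the vector \<open>v\<^sub>j = (0, - a\<^sub>j)\<close> if \<open>b\<^sub>j = 0\<close>
  and \<open>v\<^sub>j = (1, - (r / b\<^sub>j) a\<^sub>j)\<close> otherwise. Every nonzero \<open>b\<^sub>j\<close> divides the
  codenominator \<open>r\<close>, so these vectors are integral; they are primitive by the gcd condition in the first case
  and by their first coordinate in the second. Also \<open>C\<close> is the set of
  points on which all \<open>v\<^sub>j\<close> are nonnegative, its interior \<open>Co\<close> the set where they are positive, and the slices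
  of \<open>C\<close> and \<open>Co\<close> at height \<open>k\<close> count \<open>ehr(P; k/r)\<close> and \<open>ehr(P\<degree>; k/r)\<close>. All six conditions are
  compared with one: there is a lattice point \<open>p = (g, y)\<close> with \<open>v\<^sub>j \<bullet> p = 1\<close> for all \<open>j\<close>. Multiplied out, this
  is the linear system (ii).

  For the Gorenstein property (i), integrality gives \<open>v\<^sub>j \<bullet> z > 0 \<longleftrightarrow> v\<^sub>j \<bullet> z \<ge> 1\<close> on lattice points, so
  the condition implies \<open>Co = p + C\<close> on lattice points. Conversely, irredundancy and primitivity
  provide interior lattice points at lattice distance one from each facet
  (\<open>translate_eq_interior_iff\<close>). Condition (vi) is the same statement once the primitive ray
  generators of the dual cone are known to be the \<open>v\<^sub>j\<close> (\<open>primitive_ray_generator_dual_iff\<close>, by Farkas).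

  If \<open>Co = p + C\<close> on lattice points, then \<open>X\<^sup>g F = G\<close> for the generating functions \<open>F\<close>, \<open>G\<close> of \<open>C\<close> and
  \<open>Co\<close>, which contains (v). Condition (v) is formally weaker, as it is silent on heights
  below \<open>g\<close>, but growth of the counts rules out interior lattice points there
  (\<open>equal_counts_imp_translate\<close>).

  The conditions (iii) and (iv) on rational functions rest on Ehrhart reciprocity, proved
  here for cones generated by lattice points of one height \<open>m\<close>: with \<open>D = d + 1\<close>, both
  \<open>(1 - X\<^sup>m)\<^sup>D F\<close> and \<open>(1 - X\<^sup>m)\<^sup>D G\<close> are polynomials of degree at most \<open>D m\<close>, and the coefficients of
  the second are those of the first in reverse order (\<open>reciprocity\<close>). A regular triangulation cuts
  \<open>C\<close> into simplicial cones, each generic point lying in exactly one of them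
  (\<open>exists_triangulation\<close>). Fix a generic interior direction \<open>s\<close>. Assigning each lattice point \<open>x\<close> to the
  cell that contains \<open>x + t s\<close> for small \<open>t > 0\<close> decomposes \<open>C\<close> into half-open cells; \<open>x - t s\<close> instead
  decomposes \<open>Co\<close> into the same cells with the complementary walls removed. On one cell, the
  factor \<open>(1 - X\<^sup>m)\<^sup>D\<close> leaves the half-open fundamental parallelepiped, whose reflection
  exchanges the two kinds of walls (\<open>box_reflection\<close>). By reciprocity, substituting \<open>1/X\<close> in \<open>F\<close> gives
  \<open>(-1)\<^sup>D G\<close>, so that (iii) and (iv) both say \<open>X\<^sup>g F = G\<close>.
\<close>

section \<open>Counting lattice points by height\<close>

lemma lattice_points_add: "x \<in> lattice_points \<Longrightarrow> y \<in> lattice_points \<Longrightarrow> x + y \<in> lattice_points"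
  by (auto simp: lattice_points_def inner_add_left)

lemma lattice_points_diff: "x \<in> lattice_points \<Longrightarrow> y \<in> lattice_points \<Longrightarrow> x - y \<in> lattice_points"
  by (auto simp: lattice_points_def inner_diff_left)

lemma lattice_points_0: "0 \<in> lattice_points"
  by (auto simp: lattice_points_def)

lemma lattice_points_scaleR: "c \<in> \<int> \<Longrightarrow> x \<in> lattice_points \<Longrightarrow> c *\<^sub>R x \<in> lattice_points"
  by (auto simp: lattice_points_def)

lemma lattice_points_sum: "(\<And>i. i \<in> A \<Longrightarrow> f i \<in> lattice_points) \<Longrightarrow> sum f A \<in> lattice_points"
  by (induction A rule: infinite_finite_induct) (auto simp: lattice_points_0 lattice_points_add)

lemma lattice_points_inner:
  assumes "x \<in> lattice_points" "y \<in> lattice_points"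
  shows "x \<bullet> y \<in> \<int>"
  using assms by (subst euclidean_inner) (auto simp: lattice_points_def intro!: Ints_sum Ints_mult)

lemma finite_bounded_lattice_points:
  fixes S :: "'a::euclidean_space set"
  assumes "bounded S"
  shows "finite (S \<inter> lattice_points)"
proof -
  obtain K where K: "\<And>x. x \<in> S \<Longrightarrow> norm x \<le> K"
    using assms bounded_iff by blast
  define f where "f x = (\<lambda>e\<in>Basis. \<lfloor>x \<bullet> e\<rfloor>)" for x :: 'a
  have "inj_on f (S \<inter> lattice_points)"
  proof (rule inj_onI)
    fix x y assume xy: "x \<in> S \<inter> lattice_points" "y \<in> S \<inter> lattice_points" "f x = f y"
    show "x = y"
    proof (rule euclidean_eqI)
      fix e :: 'a assume e: "e \<in> Basis"
      then have "\<lfloor>x \<bullet> e\<rfloor> = \<lfloor>y \<bullet> e\<rfloor>"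
        using fun_cong[OF xy(3), of e] by (simp add: f_def)
      then show "x \<bullet> e = y \<bullet> e"
        using xy e by (auto simp: lattice_points_def elim!: Ints_cases)
    qed
  qed
  moreover have "f ` (S \<inter> lattice_points) \<subseteq> Basis \<rightarrow>\<^sub>E {\<lfloor>-K\<rfloor>..\<lfloor>K\<rfloor>}"
  proof -
    have "\<bar>x \<bullet> e\<bar> \<le> K" if "x \<in> S" "e \<in> Basis" for x e
      using Basis_le_norm[OF that(2), of x] K[OF that(1)] by linarith
    then show ?thesis
      by (fastforce simp: f_def abs_le_iff intro!: floor_mono)
  qed
  ultimately show ?thesis
    by (meson finite_PiE finite_Basis finite_atLeastAtMost_int finite_imageD finite_subset)
qed

definition height_series :: "'a::euclidean_space \<Rightarrow> 'a set \<Rightarrow> int fps" where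
  "height_series e S = Abs_fps (\<lambda>k. int (card {x \<in> S. e \<bullet> x = real k}))"

lemma height_series_nth [simp]: "fps_nth (height_series e S) k = int (card {x \<in> S. e \<bullet> x = real k})"
  by (simp add: height_series_def)

lemma one_minus_X_power_mult_nth:
  "fps_nth ((1 - fps_X ^ m) * F) k = fps_nth F k - (if k < m then 0 else fps_nth F (k - m))"
  for F :: "int fps"
  by (simp add: left_diff_distrib fps_X_power_mult_nth)

text \<open>The translate \<open>u + S\<close> has generating function \<open>X\<^sup>m\<close> times that of \<open>S\<close>, because no point of \<open>S\<close>
  has negative height. Iterated over a basis, this peels a simplicial cone down to its fundamental parallelepiped.\<close>
lemma height_series_remove_translate:
  fixes S :: "'a::euclidean_space set"
  assumes fin: "\<And>k. finite {x \<in> S. e \<bullet> x = real k}"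
    and nonneg: "\<And>x. x \<in> S \<Longrightarrow> 0 \<le> e \<bullet> x"
    and u: "e \<bullet> u = real m" and sub: "(+) u ` S \<subseteq> S"
  shows "(1 - fps_X ^ m) * height_series e S = height_series e (S - (+) u ` S)"
proof (rule fps_ext)
  fix k
  have split: "{x \<in> S - (+) u ` S. e \<bullet> x = real k}
      = {x \<in> S. e \<bullet> x = real k} - {x \<in> (+) u ` S. e \<bullet> x = real k}"
    by auto
  have "card {x \<in> (+) u ` S. e \<bullet> x = real k}
      = (if k < m then 0 else card {x \<in> S. e \<bullet> x = real (k - m)})"
  proof (cases "k < m")
    case True
    then have "{x \<in> (+) u ` S. e \<bullet> x = real k} = {}"
      using nonneg by (fastforce simp: inner_add_right u)
    then show ?thesis using True by (simp only: card.empty if_True)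
  next
    case False
    then have "{x \<in> (+) u ` S. e \<bullet> x = real k} = (+) u ` {x \<in> S. e \<bullet> x = real (k - m)}"
      by (auto simp: inner_add_right u of_nat_diff image_iff algebra_simps)
    then show ?thesis using False by (simp add: card_image)
  qed
  moreover have "card {x \<in> S - (+) u ` S. e \<bullet> x = real k}
      = card {x \<in> S. e \<bullet> x = real k} - card {x \<in> (+) u ` S. e \<bullet> x = real k}"
    unfolding split by (rule card_Diff_subset) (use sub in \<open>auto intro!: finite_subset[OF _ fin[of k]]\<close>)
  moreover have "card {x \<in> (+) u ` S. e \<bullet> x = real k} \<le> card {x \<in> S. e \<bullet> x = real k}"
    by (rule card_mono) (use sub fin in auto)
  ultimately show "fps_nth ((1 - fps_X ^ m) * height_series e S) k
      = fps_nth (height_series e (S - (+) u ` S)) k"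
    by (simp only: one_minus_X_power_mult_nth height_series_nth) (simp add: of_nat_diff)
qed

section \<open>Half-open simplicial cones\<close>

definition linear_basis :: "'a::euclidean_space set \<Rightarrow> bool" where
  "linear_basis B \<longleftrightarrow> independent B \<and> span B = UNIV"

lemma linear_basis_finite: "linear_basis B \<Longrightarrow> finite B"
  by (simp add: linear_basis_def independent_imp_finite)

lemma linear_basis_card: "linear_basis B \<Longrightarrow> card B = DIM('a)" for B :: "'a::euclidean_space set"
  by (metis linear_basis_def dim_UNIV dim_span dim_eq_card_independent)

lemma
  fixes B :: "'a::euclidean_space set"
  assumes "linear_basis B"
  shows representation_expand: "(\<Sum>b\<in>B. representation B x b *\<^sub>R b) = x"
    and representation_plus: "representation B (x + y) b = representation B x b + representation B y b"
    and representation_minus: "representation B (x - y) b = representation B x b - representation B y b"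
    and representation_uminus: "representation B (- x) b = - representation B x b"
    and representation_scaleR: "representation B (c *\<^sub>R x) b = c * representation B x b"
    and representation_base: "b \<in> B \<Longrightarrow> representation B b b' = (if b' = b then 1 else 0)"
    and representation_combination:
      "b \<in> B \<Longrightarrow> representation B (\<Sum>b\<in>B. f b *\<^sub>R b) b = f b"
proof -
  have ind: "independent B" and sp: "\<And>x. x \<in> span B" and fin: "finite B"
    using assms linear_basis_finite by (auto simp: linear_basis_def)
  show "(\<Sum>b\<in>B. representation B x b *\<^sub>R b) = x"
    by (rule real_vector.sum_representation_eq[OF ind sp fin]) auto
  show "representation B (x + y) b = representation B x b + representation B y b"
    by (simp add: real_vector.representation_add[OF ind sp sp])
  show "representation B (x - y) b = representation B x b - representation B y b"
    by (simp add: real_vector.representation_diff[OF ind sp sp])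
  show "representation B (- x) b = - representation B x b"
    by (simp add: real_vector.representation_neg[OF ind sp])
  show sc: "representation B (c *\<^sub>R x) b = c * representation B x b" for c x b
    by (simp add: real_vector.representation_scale[OF ind sp])
  show ba: "representation B b b' = (if b' = b then 1 else 0)" if "b \<in> B" for b b'
    by (simp add: real_vector.representation_basis[OF ind that])
  show "representation B (\<Sum>b\<in>B. f b *\<^sub>R b) b = f b" if "b \<in> B"
    using that fin by (simp add: real_vector.representation_sum[OF ind sp] sc ba if_distrib sum.delta
        cong: if_cong)
qed

text \<open>The set \<open>I\<close> lists the generators whose opposite wall is removed. In the box below, the side opposite
  to a removed wall is kept, so that the translates of the box tile the half-open cone.\<close>
definition half_open_cone :: "'a::euclidean_space set \<Rightarrow> 'a set \<Rightarrow> 'a set" where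
  "half_open_cone B I = {x \<in> lattice_points. \<forall>b\<in>B.
     if b \<in> I then 0 < representation B x b else 0 \<le> representation B x b}"

definition half_open_box :: "'a::euclidean_space set \<Rightarrow> 'a set \<Rightarrow> 'a set \<Rightarrow> 'a set" where
  "half_open_box B I A = {x \<in> half_open_cone B I. \<forall>b\<in>A.
     if b \<in> I then representation B x b \<le> 1 else representation B x b < 1}"

locale lattice_basis =
  fixes B :: "'a::euclidean_space set" and e :: 'a and m :: nat
  assumes basis: "linear_basis B" and lattice: "B \<subseteq> lattice_points"
    and height: "\<And>b. b \<in> B \<Longrightarrow> e \<bullet> b = real m" and m_pos: "m > 0"
begin

lemma height_eq: "e \<bullet> x = real m * (\<Sum>b\<in>B. representation B x b)"
proof -
  have "e \<bullet> x = e \<bullet> (\<Sum>b\<in>B. representation B x b *\<^sub>R b)"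
    by (simp add: representation_expand[OF basis])
  also have "\<dots> = (\<Sum>b\<in>B. representation B x b * real m)"
    by (simp add: inner_sum_right height)
  finally show ?thesis by (simp add: sum_distrib_left mult.commute)
qed

lemma half_open_cone_nonneg: "x \<in> half_open_cone B I \<Longrightarrow> b \<in> B \<Longrightarrow> 0 \<le> representation B x b"
  by (auto simp: half_open_cone_def split: if_splits dest!: bspec intro: less_imp_le)

lemma height_nonneg: "x \<in> half_open_cone B I \<Longrightarrow> 0 \<le> e \<bullet> x"
  by (simp add: height_eq half_open_cone_nonneg sum_nonneg)

lemma finite_slice: "finite {x \<in> half_open_cone B I. e \<bullet> x = real k}"
proof -
  have "norm x \<le> (\<Sum>b\<in>B. real k / real m * norm b)"
    if x: "x \<in> half_open_cone B I" "e \<bullet> x = real k" for x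
  proof -
    have le: "\<bar>representation B x b\<bar> \<le> real k / real m" if "b \<in> B" for b
    proof -
      have "representation B x b \<le> (\<Sum>b\<in>B. representation B x b)"
        by (rule member_le_sum) (use that x half_open_cone_nonneg linear_basis_finite[OF basis] in auto)
      also have "\<dots> = real k / real m"
        using height_eq[of x] x m_pos by (simp add: field_simps)
      finally show ?thesis using half_open_cone_nonneg[OF x(1) that] by simp
    qed
    have "norm x = norm (\<Sum>b\<in>B. representation B x b *\<^sub>R b)"
      by (simp add: representation_expand[OF basis])
    also have "\<dots> \<le> (\<Sum>b\<in>B. norm (representation B x b *\<^sub>R b))"
      by (rule norm_sum)
    also have "\<dots> \<le> (\<Sum>b\<in>B. real k / real m * norm b)"
      by (rule sum_mono) (use le in \<open>auto intro!: mult_right_mono simp del: times_divide_eq_left\<close>)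
    finally show ?thesis .
  qed
  then have "bounded {x \<in> half_open_cone B I. e \<bullet> x = real k}"
    unfolding bounded_iff by blast
  from finite_bounded_lattice_points[OF this] show ?thesis
    by (rule rev_finite_subset) (auto simp: half_open_cone_def)
qed

lemma height_series_box:
  assumes "A \<subseteq> B"
  shows "(1 - fps_X ^ m) ^ card A * height_series e (half_open_cone B I)
    = height_series e (half_open_box B I A)"
proof -
  have "finite A" using assms finite_subset linear_basis_finite[OF basis] by blast
  then show ?thesis using assms
  proof (induction A rule: finite_induct)
    case empty
    then show ?case by (simp add: half_open_box_def)
  next
    case (insert u A)
    let ?S = "half_open_box B I A"
    have u: "u \<in> B" "u \<in> lattice_points" using insert lattice by auto
    have rep: "representation B (u + x) b = representation B x b + (if b = u then 1 else 0)" for x b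
      using u by (simp add: representation_plus[OF basis] representation_base[OF basis])
    have sub: "(+) u ` ?S \<subseteq> ?S"
    proof (clarify)
      fix x assume x: "x \<in> ?S"
      have "u + x \<in> lattice_points"
        using x u by (auto simp: half_open_box_def half_open_cone_def intro: lattice_points_add)
      then show "u + x \<in> ?S"
        using x insert.hyps u unfolding half_open_box_def half_open_cone_def mem_Collect_eq rep
        by (auto split: if_splits simp: add_pos_pos dest!: bspec)
    qed
    have "?S - (+) u ` ?S = half_open_box B I (insert u A)"
    proof -
      have "x \<in> (+) u ` ?S \<longleftrightarrow> (if u \<in> I then 1 < representation B x u else 1 \<le> representation B x u)"
        if x: "x \<in> ?S" for x
      proof -
        have "x \<in> (+) u ` ?S \<longleftrightarrow> x - u \<in> ?S"
          by (force simp: image_iff)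
        also have "\<dots> \<longleftrightarrow> (if u \<in> I then 1 < representation B x u else 1 \<le> representation B x u)"
        proof -
          have r: "representation B (x - u) b = representation B x b - (if b = u then 1 else 0)" for b
            using u by (simp add: representation_minus[OF basis] representation_base[OF basis])
          have "x - u \<in> lattice_points"
            using x u by (auto simp: half_open_box_def half_open_cone_def intro: lattice_points_diff)
          then show ?thesis
            using x insert.hyps u unfolding half_open_box_def half_open_cone_def mem_Collect_eq r
            by (auto split: if_splits)
        qed
        finally show ?thesis .
      qed
      then show ?thesis
        by (fastforce simp: half_open_box_def split: if_splits)
    qed
    moreover have "(1 - fps_X ^ m) * height_series e ?S = height_series e (?S - (+) u ` ?S)"
    proof (rule height_series_remove_translate)
      show "finite {x \<in> ?S. e \<bullet> x = real k}" for k
        by (rule finite_subset[OF _ finite_slice[of I k]]) (auto simp: half_open_box_def)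
    qed (use sub u height height_nonneg in \<open>auto simp: half_open_box_def\<close>)
    ultimately show ?case
      using insert by (simp add: mult.assoc)
  qed
qed

lemma box_height_le:
  assumes "x \<in> half_open_box B I B"
  shows "e \<bullet> x \<le> real (DIM('a) * m)"
proof -
  have "representation B x b \<le> 1" if "b \<in> B" for b
    using assms that by (auto simp: half_open_box_def split: if_splits dest!: bspec intro: less_imp_le)
  then have "(\<Sum>b\<in>B. representation B x b) \<le> (\<Sum>b\<in>B. 1)"
    by (rule sum_mono)
  then show ?thesis
    by (simp add: height_eq linear_basis_card[OF basis] mult.commute mult_left_mono)
qed

text \<open>The reflection \<open>x \<mapsto> (\<Sum>b\<in>B. b) - x\<close> of the fundamental parallelepiped interchanges the two kinds
  of walls. It is the local form of Ehrhart reciprocity.\<close>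
lemma box_reflection:
  assumes "I \<subseteq> B" and "k \<le> DIM('a) * m"
  shows "card {x \<in> half_open_box B (B - I) B. e \<bullet> x = real k}
    = card {x \<in> half_open_box B I B. e \<bullet> x = real (DIM('a) * m - k)}"
proof -
  define w where "w = (\<Sum>b\<in>B. b)"
  have w: "w \<in> lattice_points"
    unfolding w_def using lattice by (auto intro: lattice_points_sum)
  have rw: "representation B (w - x) b = 1 - representation B x b" if "b \<in> B" for x b
    using representation_combination[OF basis that, of "\<lambda>_. 1"] 
    by (simp add: w_def representation_minus[OF basis])
  have ew: "e \<bullet> w = real (DIM('a) * m)"
    by (simp add: w_def inner_sum_right height linear_basis_card[OF basis])
  have wx: "w - x \<in> half_open_box B (B - J) B" if "x \<in> half_open_box B J B" for x J
    using that w unfolding half_open_box_def half_open_cone_def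
    by (auto simp: rw lattice_points_diff split: if_splits)
  have "bij_betw (\<lambda>x. w - x) {x \<in> half_open_box B (B - I) B. e \<bullet> x = real k}
     {x \<in> half_open_box B I B. e \<bullet> x = real (DIM('a) * m - k)}"
  proof (rule bij_betw_byWitness[where f' = "\<lambda>x. w - x"])
    show "(\<lambda>x. w - x) ` {x \<in> half_open_box B (B - I) B. e \<bullet> x = real k}
       \<subseteq> {x \<in> half_open_box B I B. e \<bullet> x = real (DIM('a) * m - k)}"
      using wx[of _ "B - I"] assms by (auto simp: inner_diff_right ew of_nat_diff double_diff)
    show "(\<lambda>x. w - x) ` {x \<in> half_open_box B I B. e \<bullet> x = real (DIM('a) * m - k)}
       \<subseteq> {x \<in> half_open_box B (B - I) B. e \<bullet> x = real k}"
      using wx[of _ I] assms by (auto simp: inner_diff_right ew of_nat_diff)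
  qed auto
  then show ?thesis by (rule bij_betw_same_card)
qed

end

section \<open>A triangulation counting every generic point once\<close>

definition simplicial_cone :: "'a::euclidean_space set \<Rightarrow> 'a set" where
  "simplicial_cone B = {x. \<forall>b\<in>B. 0 \<le> representation B x b}"

definition generic :: "'a::euclidean_space set \<Rightarrow> 'a \<Rightarrow> bool" where
  "generic U x \<longleftrightarrow> (\<forall>A\<subseteq>U. x \<in> span A \<longrightarrow> span A = UNIV)"

text \<open>The value at \<open>x\<close> of the linear functional that agrees with \<open>w\<close> on the basis \<open>B\<close>.\<close>
definition lift :: "('a::euclidean_space \<Rightarrow> real) \<Rightarrow> 'a set \<Rightarrow> 'a \<Rightarrow> real" where
  "lift w B x = (\<Sum>b\<in>B. representation B x b * w b)"

text \<open>The regular triangulation induced by \<open>w\<close>: the cells are the lower faces of the cone over the points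
  \<open>(u, w u)\<close>.\<close>
definition triangulation :: "('a::euclidean_space \<Rightarrow> real) \<Rightarrow> 'a set \<Rightarrow> 'a set set" where
  "triangulation w U = {B. B \<subseteq> U \<and> linear_basis B \<and> (\<forall>k\<in>U - B. lift w B k < w k)}"

lemma representation_eq_0_imp_span:
  fixes B :: "'a::euclidean_space set"
  assumes "linear_basis B" "b \<in> B" "representation B x b = 0"
  shows "x \<in> span (B - {b})"
proof -
  have "x = (\<Sum>b'\<in>B. representation B x b' *\<^sub>R b')"
    by (simp add: representation_expand[OF assms(1)])
  also have "\<dots> = (\<Sum>b'\<in>B - {b}. representation B x b' *\<^sub>R b')"
    by (rule sum.mono_neutral_right) (use assms linear_basis_finite in auto)
  also have "\<dots> \<in> span (B - {b})"
    by (intro span_sum span_scale span_base)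
  finally show ?thesis .
qed

lemma span_imp_representation_eq_0:
  fixes B :: "'a::euclidean_space set"
  assumes "linear_basis B" "x \<in> span (B - {b})"
  shows "representation B x b = 0"
proof -
  have "representation B x = representation (B - {b}) x"
    by (rule real_vector.representation_extend) (use assms in \<open>auto simp: linear_basis_def\<close>)
  then show ?thesis
    by (metis Diff_iff insertI1 real_vector.representation_ne_zero)
qed

lemma generic_representation_nonzero:
  assumes "generic U x" "B \<subseteq> U" "linear_basis B" "b \<in> B"
  shows "representation B x b \<noteq> 0"
proof
  assume "representation B x b = 0"
  then have "x \<in> span (B - {b})"
    using representation_eq_0_imp_span assms by blast
  then have "span (B - {b}) = UNIV"
    using assms(1,2) unfolding generic_def by blast
  then have "b \<in> span (B - {b})" by simp
  then show False
    using assms(3,4) by (auto simp: linear_basis_def dependent_def)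
qed

lemma linear_basisI:
  fixes B :: "'a::euclidean_space set"
  assumes "independent B" "card B = DIM('a)"
  shows "linear_basis B"
proof -
  have "UNIV \<subseteq> span B"
    by (rule card_ge_dim_independent) (use assms in auto)
  then show ?thesis using assms by (auto simp: linear_basis_def)
qed

text \<open>Powers of a suitable number serve as weights: each dependence to be avoided is a root of one
  of finitely many nonzero polynomials.\<close>
lemma exists_generic_weights:
  fixes U :: "'a::euclidean_space set"
  assumes "finite U"
  shows "\<exists>w. \<forall>B\<subseteq>U. linear_basis B \<longrightarrow> (\<forall>k\<in>U - B. lift w B k \<noteq> w k)"
proof -
  obtain idx :: "'a \<Rightarrow> nat" where idx: "inj_on idx U"
    using finite_imp_inj_to_nat_seg[OF assms] by blast
  define p where "p B k = monom 1 (idx k) - (\<Sum>b\<in>B. monom (representation B k b) (idx b))" for B k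
  have p: "p B k \<noteq> 0" if "B \<subseteq> U" "k \<in> U - B" for B k
  proof -
    have "coeff (p B k) (idx k) = 1 - (\<Sum>b\<in>B. if idx b = idx k then representation B k b else 0)"
      by (simp add: p_def coeff_sum)
    also have "(\<Sum>b\<in>B. if idx b = idx k then representation B k b else 0) = 0"
      by (rule sum.neutral) (use that idx in \<open>auto simp: inj_on_def\<close>)
    finally show ?thesis by auto
  qed
  have "finite (\<Union>B\<in>Pow U. \<Union>k\<in>U - B. {t. poly (p B k) t = 0})"
    using assms p by (intro finite_UN_I) (auto intro!: poly_roots_finite)
  then obtain t where t: "t \<notin> (\<Union>B\<in>Pow U. \<Union>k\<in>U - B. {t. poly (p B k) t = 0})"
    using ex_new_if_finite infinite_UNIV_char_0 by blast
  have "lift (\<lambda>u. t ^ idx u) B k \<noteq> t ^ idx k" if "B \<subseteq> U" "k \<in> U - B" for B k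
  proof -
    have "poly (p B k) t \<noteq> 0" using t that by auto
    then show ?thesis
      by (auto simp: p_def poly_sum poly_monom lift_def)
  qed
  then show ?thesis by (intro exI[of _ "\<lambda>u. t ^ idx u"]) auto
qed

locale homogeneous_generators =
  fixes U :: "'a::euclidean_space set" and e :: 'a and m :: nat
  assumes finite_U: "finite U" and height: "\<And>u. u \<in> U \<Longrightarrow> e \<bullet> u = real m" and m_pos: "m > 0"
begin

definition cone_U :: "'a set" where
  "cone_U = {c *\<^sub>R y | c y. 0 \<le> c \<and> y \<in> convex hull U}"

text \<open>This is Carath\'eodory's theorem for cones; the common height of the generators saves one
  vector, and genericity forces the remaining \<open>DIM('a)\<close> vectors to be a basis.\<close>
lemma generic_in_some_simplicial_cone:
  assumes "generic U x" "x \<in> cone_U"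
  obtains B where "B \<subseteq> U" "linear_basis B" "x \<in> simplicial_cone B"
proof -
  obtain c y where c: "0 \<le> c" "x = c *\<^sub>R y" "y \<in> convex hull U"
    using assms by (auto simp: cone_U_def)
  obtain u where "u \<in> U" using c(3) by fastforce
  then have "e \<noteq> 0" using height[of u] m_pos by auto
  have "aff_dim U \<le> aff_dim {x. e \<bullet> x = real m}"
    by (rule aff_dim_subset) (use height in auto)
  also have "\<dots> = int DIM('a) - 1"
    using \<open>e \<noteq> 0\<close> by (simp add: aff_dim_hyperplane)
  finally have ad: "aff_dim U + 1 \<le> int DIM('a)" by simp
  obtain S where S: "finite S" "S \<subseteq> U" "int (card S) \<le> aff_dim U + 1" "y \<in> convex hull S"
    using c(3) caratheodory_aff_dim[of U] by auto
  have "y \<in> span S" using S(4) convex_hull_subset_span by blast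
  then have spS: "span S = UNIV"
    using assms(1) S(2) c(2) by (auto simp: generic_def span_scale)
  moreover have "independent S"
    by (rule card_le_dim_spanning[where V = UNIV]) (use S ad spS in auto)
  ultimately have bS: "linear_basis S" by (simp add: linear_basis_def)
  obtain f where f: "\<forall>v\<in>S. 0 \<le> f v" "(\<Sum>v\<in>S. f v *\<^sub>R v) = y"
    using S(4) by (auto simp: convex_hull_finite[OF S(1)])
  have "x = (\<Sum>v\<in>S. (c * f v) *\<^sub>R v)"
    by (simp add: c(2) scaleR_sum_right flip: f(2))
  then have "x \<in> simplicial_cone S"
    using f(1) c(1) by (auto simp: simplicial_cone_def representation_combination[OF bS, where f = "\<lambda>v. c * f v"])
  then show ?thesis using S bS that by blast
qed

lemma simplicial_cone_subset:
  assumes "B \<subseteq> U" "linear_basis B"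
  shows "simplicial_cone B \<subseteq> cone_U"
proof
  fix x assume x: "x \<in> simplicial_cone B"
  let ?r = "\<lambda>b. representation B x b"
  define c where "c = (\<Sum>b\<in>B. ?r b)"
  have fin: "finite B" using assms linear_basis_finite by blast
  have nn: "\<And>b. b \<in> B \<Longrightarrow> 0 \<le> ?r b" using x by (simp add: simplicial_cone_def)
  have xe: "(\<Sum>b\<in>B. ?r b *\<^sub>R b) = x" by (simp add: representation_expand[OF assms(2)])
  have "B \<noteq> {}" using assms(2) linear_basis_card by fastforce
  then obtain b0 where b0: "b0 \<in> B" by blast
  show "x \<in> cone_U"
  proof (cases "c = 0")
    case True
    then have "\<And>b. b \<in> B \<Longrightarrow> ?r b = 0"
      using fin nn by (simp add: c_def sum_nonneg_eq_0_iff)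
    then have "(\<Sum>b\<in>B. ?r b *\<^sub>R b) = 0" by simp
    then have "x = 0 *\<^sub>R b0" using xe by simp
    moreover have "b0 \<in> convex hull U" using b0 assms(1) by (auto intro: hull_inc)
    ultimately show ?thesis unfolding cone_U_def
      by (intro CollectI exI[of _ 0] exI[of _ b0]) simp
  next
    case False
    then have cpos: "c > 0" using nn unfolding c_def by (metis less_eq_real_def sum_nonneg)
    let ?y = "\<Sum>b\<in>B. (?r b / c) *\<^sub>R b"
    have "?y \<in> convex hull B"
      unfolding convex_hull_finite[OF fin]
    proof (intro CollectI exI[of _ "\<lambda>b. ?r b / c"] conjI ballI)
      show "(\<Sum>b\<in>B. ?r b / c) = 1"
        using cpos c_def by (metis div_self less_irrefl sum_divide_distrib)
    qed (use nn cpos in auto)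
    then have "?y \<in> convex hull U"
      using hull_mono[OF assms(1)] by blast
    moreover have "x = c *\<^sub>R ?y"
      using cpos xe by (simp add: scaleR_sum_right)
    ultimately show ?thesis using cpos unfolding cone_U_def
      by (intro CollectI exI[of _ c] exI[of _ ?y]) simp
  qed
qed

text \<open>One step of the simplex method. The common height of the generators makes the coordinates of \<open>k\<close> sum
  to one, so one of them is positive and the ratio test finds a vector \<open>b0\<close> to remove;
  genericity of \<open>x\<close> makes the step length positive.\<close>
lemma pivot:
  assumes B: "B \<subseteq> U" "linear_basis B" and x: "generic U x" "x \<in> simplicial_cone B"
    and k: "k \<in> U - B" "w k < lift w B k"
  obtains B' where "B' \<subseteq> U" "linear_basis B'" "x \<in> simplicial_cone B'" "lift w B' x < lift w B x"
proof -
  let ?r = "\<lambda>b. representation B x b" and ?c = "\<lambda>b. representation B k b"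
  have fin: "finite B" using B linear_basis_finite by blast
  have rpos: "0 < ?r b" if "b \<in> B" for b
    using x B generic_representation_nonzero[OF x(1) B that] that
    by (auto simp: simplicial_cone_def order.strict_iff_order)
  have "e \<bullet> k = e \<bullet> (\<Sum>b\<in>B. ?c b *\<^sub>R b)"
    by (simp add: representation_expand[OF B(2)])
  also have "\<dots> = (\<Sum>b\<in>B. ?c b * real m)"
    by (simp add: inner_sum_right) (rule sum.cong, use B height in auto)
  finally have "(\<Sum>b\<in>B. ?c b) = 1"
    using k height m_pos by (simp flip: sum_distrib_right)
  then have "\<exists>b\<in>B. ?c b > 0"
    by (metis not_less sum_nonpos zero_less_one)
  define Q where "Q = {b \<in> B. ?c b > 0}"
  have Q: "finite Q" "Q \<noteq> {}" using \<open>\<exists>b\<in>B. ?c b > 0\<close> fin by (auto simp: Q_def)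
  define \<theta> where "\<theta> = Min ((\<lambda>b. ?r b / ?c b) ` Q)"
  have "\<theta> \<in> (\<lambda>b. ?r b / ?c b) ` Q" unfolding \<theta>_def using Q by (intro Min_in) auto
  then obtain b0 where b0: "b0 \<in> B" "?c b0 > 0" "\<theta> = ?r b0 / ?c b0" by (auto simp: Q_def)
  have \<theta>: "\<theta> > 0" using b0 rpos by simp
  have nn: "0 \<le> ?r b - \<theta> * ?c b" if "b \<in> B" for b
  proof (cases "?c b > 0")
    case True
    then have "\<theta> \<le> ?r b / ?c b" unfolding \<theta>_def using Q that by (intro Min_le) (auto simp: Q_def)
    then show ?thesis using True by (simp add: field_simps)
  next
    case False
    then have "\<theta> * ?c b \<le> 0" using \<theta> by (simp add: mult_nonneg_nonpos)
    then show ?thesis using rpos[OF that] by simp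
  qed
  define B' where "B' = insert k (B - {b0})"
  have kB: "k \<notin> B - {b0}" using k by auto
  have "k \<notin> span (B - {b0})"
    using span_imp_representation_eq_0[OF B(2), of k b0] b0 by auto
  moreover have "independent (B - {b0})"
    using B(2) by (meson Diff_subset independent_mono linear_basis_def)
  ultimately have "independent B'"
    unfolding B'_def by (simp add: independent_insert)
  moreover have "card B' = DIM('a)"
    using linear_basis_card[OF B(2)] b0(1) kB fin unfolding B'_def
    by (simp add: card_Suc_Diff1)
  ultimately have B'b: "linear_basis B'" by (rule linear_basisI)
  define f where "f b = (if b = k then \<theta> else ?r b - \<theta> * ?c b)" for b
  have gsum: "(\<Sum>b\<in>B'. f b *\<^sub>R h b) = \<theta> *\<^sub>R h k + (\<Sum>b\<in>B. ?r b *\<^sub>R h b) - \<theta> *\<^sub>R (\<Sum>b\<in>B. ?c b *\<^sub>R h b)"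
    for h :: "'a \<Rightarrow> 'b::real_vector"
  proof -
    have "(\<Sum>b\<in>B'. f b *\<^sub>R h b) = \<theta> *\<^sub>R h k + (\<Sum>b\<in>B - {b0}. f b *\<^sub>R h b)"
      using kB fin by (simp add: B'_def f_def)
    also have "(\<Sum>b\<in>B - {b0}. f b *\<^sub>R h b) = (\<Sum>b\<in>B - {b0}. (?r b - \<theta> * ?c b) *\<^sub>R h b)"
      by (rule sum.cong) (use kB in \<open>auto simp: f_def\<close>)
    also have "\<dots> = (\<Sum>b\<in>B. (?r b - \<theta> * ?c b) *\<^sub>R h b)"
      by (rule sum.mono_neutral_left) (use fin b0 in auto)
    also have "\<dots> = (\<Sum>b\<in>B. ?r b *\<^sub>R h b) - \<theta> *\<^sub>R (\<Sum>b\<in>B. ?c b *\<^sub>R h b)"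
      by (simp add: scaleR_left_diff_distrib sum_subtractf scaleR_sum_right)
    finally show ?thesis by simp
  qed
  have xf: "(\<Sum>b\<in>B'. f b *\<^sub>R b) = x"
    using gsum[of "\<lambda>b. b"] by (simp add: representation_expand[OF B(2)])
  have rf: "representation B' x b = f b" if "b \<in> B'" for b
    using representation_combination[OF B'b that, of f] by (simp add: xf)
  have "x \<in> simplicial_cone B'"
    using \<theta> nn rf by (auto simp: simplicial_cone_def f_def B'_def)
  moreover have "lift w B' x < lift w B x"
  proof -
    have "lift w B' x = (\<Sum>b\<in>B'. f b *\<^sub>R w b)"
      unfolding lift_def by (rule sum.cong) (auto simp: rf)
    also have "\<dots> = lift w B x - \<theta> * (lift w B k - w k)"
      unfolding gsum[of w] by (simp add: lift_def algebra_simps)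
    finally show ?thesis using \<theta> k by simp
  qed
  ultimately show ?thesis
    using that[OF _ B'b] B k by (auto simp: B'_def)
qed

text \<open>Among the bases whose cone contains \<open>x\<close>, one of least weight at \<open>x\<close> admits no pivot, so
  all other generators lie above its functional.\<close>
lemma triangulation_covers:
  assumes w: "\<And>B k. B \<subseteq> U \<Longrightarrow> linear_basis B \<Longrightarrow> k \<in> U - B \<Longrightarrow> lift w B k \<noteq> w k"
    and x: "generic U x" "x \<in> cone_U"
  obtains B where "B \<in> triangulation w U" "x \<in> simplicial_cone B"
proof -
  define K where "K = {B. B \<subseteq> U \<and> linear_basis B \<and> x \<in> simplicial_cone B}"
  have K: "finite K" "K \<noteq> {}"
  proof -
    show "finite K" by (rule finite_subset[of _ "Pow U"]) (use finite_U in \<open>auto simp: K_def\<close>)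
    show "K \<noteq> {}" using generic_in_some_simplicial_cone[OF x] by (auto simp: K_def)
  qed
  have "Min ((\<lambda>B. lift w B x) ` K) \<in> (\<lambda>B. lift w B x) ` K"
    using K by (intro Min_in) auto
  then obtain B where B: "B \<in> K" "lift w B x = Min ((\<lambda>B. lift w B x) ` K)" by auto
  have min: "lift w B x \<le> lift w B' x" if "B' \<in> K" for B'
    unfolding B(2) using K that by (intro Min_le) auto
  have B': "B \<subseteq> U" "linear_basis B" "x \<in> simplicial_cone B" using B by (auto simp: K_def)
  have "lift w B k < w k" if k: "k \<in> U - B" for k
  proof (rule ccontr)
    assume "\<not> lift w B k < w k"
    then have "w k < lift w B k" using w[OF B'(1,2) k] by simp
    then obtain B'' where "B'' \<subseteq> U" "linear_basis B''" "x \<in> simplicial_cone B''" "lift w B'' x < lift w B x"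
      using pivot[OF B'(1,2) x(1) B'(3) k] by blast
    then show False using min[of B''] by (simp add: K_def)
  qed
  then show ?thesis using that B' by (auto simp: triangulation_def)
qed

text \<open>The functional of a cell is at most \<open>w\<close> on all generators, with equality only on the cell
  itself. At a generic point common to two distinct cells, each of the two functionals would therefore
  be smaller than the other.\<close>
lemma triangulation_overlap:
  assumes x: "generic U x" and BB: "B \<in> triangulation w U" "B' \<in> triangulation w U"
    and xB: "x \<in> simplicial_cone B" "x \<in> simplicial_cone B'"
  shows "B = B'"
proof -
  have main: "lift w B x \<le> lift w B' x \<and> (lift w B x = lift w B' x \<longrightarrow> B' \<subseteq> B)"
    if BB: "B \<in> triangulation w U" "B' \<in> triangulation w U" and xB': "x \<in> simplicial_cone B'" for B B'
  proof -
    have b: "linear_basis B" "linear_basis B'" "B' \<subseteq> U" using BB by (auto simp: triangulation_def)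
    have fin: "finite B'" using b linear_basis_finite by blast
    have lift_base: "lift w B k \<le> w k \<and> (lift w B k = w k \<longrightarrow> k \<in> B)" if "k \<in> U" for k
    proof (cases "k \<in> B")
      case True
      then have "lift w B k = w k"
        using linear_basis_finite[OF b(1)]
        by (simp add: lift_def representation_base[OF b(1)] if_distrib[of "\<lambda>z. z * _"] cong: if_cong)
      then show ?thesis using True by simp
    next
      case False
      then have "lift w B k < w k" using BB that by (auto simp: triangulation_def)
      then show ?thesis by simp
    qed
    have "linear (lift w B)"
      by (rule linearI)
        (simp_all add: lift_def representation_plus[OF b(1)] representation_scaleR[OF b(1)]
          sum_distrib_left algebra_simps sum.distrib)
    then have lx: "lift w B x = (\<Sum>b\<in>B'. representation B' x b * lift w B b)"
      by (subst (1) representation_expand[OF b(2), of x, symmetric])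
        (simp add: linear_sum linear_scale)
    have pos: "0 < representation B' x b" if "b \<in> B'" for b
      using xB' generic_representation_nonzero[OF x b(3,2) that] that
      by (auto simp: simplicial_cone_def order.strict_iff_order)
    have le: "representation B' x b * lift w B b \<le> representation B' x b * w b" if "b \<in> B'" for b
      using pos[OF that] lift_base[of b] that b by (auto simp: mult_left_mono)
    have "B' \<subseteq> B" if "lift w B x = lift w B' x"
    proof
      fix k assume k: "k \<in> B'"
      show "k \<in> B"
      proof (rule ccontr)
        assume "k \<notin> B"
        then have "lift w B k < w k" using lift_base[of k] k b by force
        then have "representation B' x k * lift w B k < representation B' x k * w k"
          using pos[OF k] by simp
        then have "lift w B x < lift w B' x"
          unfolding lx by (subst lift_def, intro sum_strict_mono_ex1[OF fin]) (use le k in blast)+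
        then show False using that by simp
      qed
    qed
    moreover have "lift w B x \<le> lift w B' x"
      unfolding lx by (subst lift_def, rule sum_mono, rule le)
    ultimately show ?thesis by simp
  qed
  have "lift w B x = lift w B' x"
    using main[OF BB xB(2)] main[OF BB(2,1) xB(1)] by simp
  then have "B' \<subseteq> B" "B \<subseteq> B'"
    using main[OF BB xB(2)] main[OF BB(2,1) xB(1)] by auto
  then show ?thesis by simp
qed

lemma exists_triangulation:
  obtains T where "finite T" "\<And>B. B \<in> T \<Longrightarrow> B \<subseteq> U \<and> linear_basis B"
    "\<And>x. generic U x \<Longrightarrow> card {B \<in> T. x \<in> simplicial_cone B} = (if x \<in> cone_U then 1 else 0)"
proof -
  obtain w where w: "\<forall>B\<subseteq>U. linear_basis B \<longrightarrow> (\<forall>k\<in>U - B. lift w B k \<noteq> w k)"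
    using exists_generic_weights[OF finite_U] by blast
  show ?thesis
  proof (rule that[of "triangulation w U"])
    show "finite (triangulation w U)"
      by (rule finite_subset[of _ "Pow U"]) (use finite_U in \<open>auto simp: triangulation_def\<close>)
    show cell: "B \<subseteq> U \<and> linear_basis B" if "B \<in> triangulation w U" for B
      using that by (simp add: triangulation_def)
    fix x assume x: "generic U x"
    show "card {B \<in> triangulation w U. x \<in> simplicial_cone B} = (if x \<in> cone_U then 1 else 0)"
    proof (cases "x \<in> cone_U")
      case True
      then obtain B where B: "B \<in> triangulation w U" "x \<in> simplicial_cone B"
        using triangulation_covers[of w, OF _ x] w by blast
      then have "{B \<in> triangulation w U. x \<in> simplicial_cone B} = {B}"
        using triangulation_overlap[OF x] by blast
      then show ?thesis using True by simp
    next
      case False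
      then have "{B \<in> triangulation w U. x \<in> simplicial_cone B} = {}"
        using simplicial_cone_subset cell by blast
      then show ?thesis using False by (simp only: card.empty if_False)
    qed
  qed
qed

end

section \<open>Reciprocity\<close>

lemma eventually_perturb_nonneg:
  fixes \<alpha> \<beta> :: real
  assumes "\<beta> \<noteq> 0"
  shows "eventually (\<lambda>t. 0 \<le> \<alpha> + t * \<beta> \<longleftrightarrow> (if \<beta> < 0 then 0 < \<alpha> else 0 \<le> \<alpha>)) (at_right 0)"
proof (cases "\<alpha> = 0")
  case True
  then show ?thesis
    using assms eventually_at_right_less[of "0::real"]
    by (auto elim!: eventually_mono simp: zero_le_mult_iff not_less)
next
  case False
  have "((\<lambda>t. \<alpha> + t * \<beta>) \<longlongrightarrow> \<alpha> + 0 * \<beta>) (at_right 0)"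
    by (intro tendsto_intros)
  then have lim: "((\<lambda>t. \<alpha> + t * \<beta>) \<longlongrightarrow> \<alpha>) (at_right 0)" by simp
  show ?thesis
  proof (cases "\<alpha> > 0")
    case True
    then show ?thesis using order_tendstoD(1)[OF lim, of 0]
      by (auto elim!: eventually_mono)
  next
    case False
    then have "\<alpha> < 0" using \<open>\<alpha> \<noteq> 0\<close> by simp
    then show ?thesis using order_tendstoD(2)[OF lim, of 0]
      by (auto elim!: eventually_mono)
  qed
qed

lemma eventually_perturb_simplicial:
  fixes x s :: "'a::euclidean_space"
  assumes B: "linear_basis B" and s: "\<And>b. b \<in> B \<Longrightarrow> representation B s b \<noteq> 0"
    and x: "x \<in> lattice_points"
  shows "eventually (\<lambda>t. x + t *\<^sub>R s \<in> simplicial_cone B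
    \<longleftrightarrow> x \<in> half_open_cone B {b\<in>B. representation B s b < 0}) (at_right 0)"
proof -
  have "eventually (\<lambda>t. \<forall>b\<in>B. 0 \<le> representation B x b + t * representation B s b
      \<longleftrightarrow> (if representation B s b < 0 then 0 < representation B x b else 0 \<le> representation B x b))
    (at_right 0)"
    by (intro eventually_ball_finite linear_basis_finite[OF B] ballI eventually_perturb_nonneg s)
  then show ?thesis
    by (rule eventually_mono)
      (auto simp: simplicial_cone_def half_open_cone_def representation_plus[OF B]
        representation_scaleR[OF B] x)
qed

lemma generic_uminus: "generic U s \<Longrightarrow> generic U (- s)"
  unfolding generic_def by (metis minus_minus span_neg)

text \<open>A line in direction \<open>s\<close> meets each proper subspace spanned by generators in at most one point, as
  \<open>s\<close> lies in none of them.\<close>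
lemma eventually_perturb_generic:
  fixes x s :: "'a::euclidean_space"
  assumes "finite U" "generic U s"
  shows "eventually (\<lambda>t. generic U (x + t *\<^sub>R s)) (at_right (0::real))"
proof -
  have "eventually (\<lambda>t. x + t *\<^sub>R s \<in> span A \<longrightarrow> span A = UNIV) (at_right (0::real))"
    if "A \<subseteq> U" for A
  proof (cases "span A = UNIV")
    case False
    then have s: "s \<notin> span A" using assms(2) that by (auto simp: generic_def)
    have uniq: "t = t'" if t: "x + t *\<^sub>R s \<in> span A" "x + t' *\<^sub>R s \<in> span A" for t t'
    proof (rule ccontr)
      assume "t \<noteq> t'"
      have "(x + t *\<^sub>R s) - (x + t' *\<^sub>R s) \<in> span A" using t by (rule span_diff)
      then have "(t - t') *\<^sub>R s \<in> span A"
        by (simp add: scaleR_left_diff_distrib)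
      then have "(1 / (t - t')) *\<^sub>R ((t - t') *\<^sub>R s) \<in> span A"
        by (rule span_scale)
      then show False using s \<open>t \<noteq> t'\<close> by simp
    qed
    show ?thesis
    proof (cases "\<exists>t. x + t *\<^sub>R s \<in> span A")
      case True
      then obtain t0 where t0: "x + t0 *\<^sub>R s \<in> span A" by blast
      have "eventually (\<lambda>t. t \<noteq> t0) (at_right (0::real))"
      proof (cases "t0 \<le> 0")
        case True
        then show ?thesis using eventually_at_right_less[of "0::real"]
          by (auto elim!: eventually_mono)
      next
        case False
        then show ?thesis using eventually_at_right_real[of 0 t0]
          by (auto elim!: eventually_mono)
      qed
      then show ?thesis by (rule eventually_mono) (use uniq t0 in blast)
    qed auto
  qed auto
  then have "eventually (\<lambda>t. \<forall>A\<in>Pow U. x + t *\<^sub>R s \<in> span A \<longrightarrow> span A = UNIV) (at_right (0::real))"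
    by (intro eventually_ball_finite) (use assms in auto)
  then show ?thesis by (simp add: generic_def Pow_def)
qed

lemma open_contains_generic:
  fixes U S :: "'a::euclidean_space set"
  assumes "finite U" "open S" "S \<noteq> {}"
  shows "\<exists>s\<in>S. generic U s"
proof (rule ccontr)
  assume "\<not> ?thesis"
  then have "\<And>s. s \<in> S \<Longrightarrow> \<exists>A\<subseteq>U. s \<in> span A \<and> span A \<noteq> UNIV"
    by (simp add: generic_def)
  then have "S \<subseteq> \<Union> (span ` {A \<in> Pow U. span A \<noteq> UNIV})"
  proof (intro subsetI)
    fix s assume "s \<in> S"
    then obtain A where A: "A \<subseteq> U" "s \<in> span A" "span A \<noteq> UNIV"
      using \<open>\<And>s. s \<in> S \<Longrightarrow> \<exists>A\<subseteq>U. s \<in> span A \<and> span A \<noteq> UNIV\<close> by meson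
    then have "span A \<in> span ` {A \<in> Pow U. span A \<noteq> UNIV}" by simp
    then show "s \<in> \<Union> (span ` {A \<in> Pow U. span A \<noteq> UNIV})" using A(2) by (rule UnionI)
  qed
  moreover have "negligible (\<Union> (span ` {A \<in> Pow U. span A \<noteq> UNIV}))"
  proof (rule negligible_Union)
    show "finite (span ` {A \<in> Pow U. span A \<noteq> UNIV})"
      using assms by simp
    fix N assume "N \<in> span ` {A \<in> Pow U. span A \<noteq> UNIV}"
    then obtain A where A: "N = span A" "span A \<noteq> UNIV" by auto
    then have "dim A < DIM('a)"
      using dim_eq_full[of A] dim_subset_UNIV[of A] by linarith
    then show "negligible N" using A by (simp add: negligible_lowdim)
  qed
  ultimately show False
    using open_not_negligible[OF assms(2,3)] negligible_subset by metis
qed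

text \<open>The point \<open>x\<close> is counted in the cell that contains \<open>x + t *\<^sub>R s\<close> for all small \<open>t > 0\<close>, and these
  points are generic, hence in exactly one cell. The set \<open>D\<close> is the closed cone for \<open>s\<close> in the interior
  and the open cone for \<open>- s\<close> in the interior.\<close>
lemma half_open_decomposition:
  fixes x s :: "'a::euclidean_space"
  assumes U: "finite U" and s: "generic U s" and x: "x \<in> lattice_points"
    and T: "finite T" "\<And>B. B \<in> T \<Longrightarrow> B \<subseteq> U \<and> linear_basis B"
    and count: "\<And>x. generic U x \<Longrightarrow> card {B \<in> T. x \<in> simplicial_cone B} = (if x \<in> C then 1 else 0)"
    and D: "eventually (\<lambda>t. x + t *\<^sub>R s \<in> C \<longleftrightarrow> x \<in> D) (at_right 0)"
  shows "card {B \<in> T. x \<in> half_open_cone B {b\<in>B. representation B s b < 0}}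
    = (if x \<in> D then 1 else 0)"
proof -
  have "eventually (\<lambda>t. \<forall>B\<in>T. x + t *\<^sub>R s \<in> simplicial_cone B
      \<longleftrightarrow> x \<in> half_open_cone B {b\<in>B. representation B s b < 0}) (at_right 0)"
    by (intro eventually_ball_finite ballI eventually_perturb_simplicial)
      (use T generic_representation_nonzero[OF s] x in \<open>blast+\<close>)
  moreover note D eventually_perturb_generic[OF U s, of x]
  ultimately have "eventually (\<lambda>t. (\<forall>B\<in>T. x + t *\<^sub>R s \<in> simplicial_cone B
      \<longleftrightarrow> x \<in> half_open_cone B {b\<in>B. representation B s b < 0})
      \<and> (x + t *\<^sub>R s \<in> C \<longleftrightarrow> x \<in> D) \<and> generic U (x + t *\<^sub>R s)) (at_right (0::real))"
    by (simp add: eventually_conj_iff)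
  then obtain t :: real where t: "\<forall>B\<in>T. x + t *\<^sub>R s \<in> simplicial_cone B
      \<longleftrightarrow> x \<in> half_open_cone B {b\<in>B. representation B s b < 0}"
      "x + t *\<^sub>R s \<in> C \<longleftrightarrow> x \<in> D" "generic U (x + t *\<^sub>R s)"
    using eventually_happens[of _ "at_right (0::real)"] by (auto simp: trivial_limit_at_right_real)
  have "{B \<in> T. x \<in> half_open_cone B {b\<in>B. representation B s b < 0}}
      = {B \<in> T. x + t *\<^sub>R s \<in> simplicial_cone B}"
    using t(1) by blast
  then show ?thesis using count[OF t(3)] t(2) by simp
qed

lemma sum_height_series_half_open:
  fixes D :: "'a::euclidean_space set"
  assumes T: "finite T" and fin: "\<And>k. finite {x \<in> D \<inter> lattice_points. e \<bullet> x = real k}"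
    and count: "\<And>x. x \<in> lattice_points \<Longrightarrow>
      card {B \<in> T. x \<in> half_open_cone B (I B)} = (if x \<in> D then 1 else 0)"
  shows "height_series e (D \<inter> lattice_points) = (\<Sum>B\<in>T. height_series e (half_open_cone B (I B)))"
proof (rule fps_ext)
  fix k
  let ?X = "{x \<in> D \<inter> lattice_points. e \<bullet> x = real k}"
  have sub: "half_open_cone B (I B) \<subseteq> D" if "B \<in> T" for B
  proof
    fix x assume x: "x \<in> half_open_cone B (I B)"
    then have "{B \<in> T. x \<in> half_open_cone B (I B)} \<noteq> {}" using that by blast
    then have "card {B \<in> T. x \<in> half_open_cone B (I B)} \<noteq> 0" using T by simp
    moreover have "x \<in> lattice_points" using x by (simp add: half_open_cone_def)
    ultimately show "x \<in> D" using count[of x] by (simp split: if_splits)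
  qed
  have eq: "{x \<in> half_open_cone B (I B). e \<bullet> x = real k} = {x \<in> ?X. x \<in> half_open_cone B (I B)}"
    if "B \<in> T" for B
  proof -
    have "half_open_cone B (I B) \<subseteq> lattice_points" by (auto simp: half_open_cone_def)
    then show ?thesis using sub[OF that] by blast
  qed
  have "(\<Sum>B\<in>T. card {x \<in> ?X. x \<in> half_open_cone B (I B)}) = 1 * card ?X"
    by (rule sum_multicount) (use T fin[of k] count in auto)
  then have "(\<Sum>B\<in>T. card {x \<in> half_open_cone B (I B). e \<bullet> x = real k}) = card ?X"
    using eq by simp
  then show "fps_nth (height_series e (D \<inter> lattice_points)) k
      = fps_nth (\<Sum>B\<in>T. height_series e (half_open_cone B (I B))) k"
    by (simp add: fps_sum_nth flip: of_nat_sum)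
qed

lemma fps_of_poly_truncate:
  fixes F :: "'a::comm_ring_1 fps"
  assumes "\<And>k. k > N \<Longrightarrow> fps_nth F k = 0"
  obtains h where "fps_of_poly h = F" "degree h \<le> N"
proof
  let ?h = "\<Sum>k\<le>N. monom (fps_nth F k) k"
  have co: "coeff ?h k = (if k \<le> N then fps_nth F k else 0)" for k
    by (simp add: coeff_sum)
  show "fps_of_poly ?h = F"
    by (rule fps_ext) (use assms in \<open>auto simp: co\<close>)
  show "degree ?h \<le> N"
    by (rule degree_le) (auto simp: co)
qed

context homogeneous_generators
begin

lemma finite_cone_slice: "finite {x \<in> cone_U \<inter> lattice_points. e \<bullet> x = real k}"
proof -
  have "{x \<in> cone_U. e \<bullet> x = real k} \<subseteq> (\<lambda>y. (real k / real m) *\<^sub>R y) ` (convex hull U)"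
  proof
    fix x assume "x \<in> {x \<in> cone_U. e \<bullet> x = real k}"
    then obtain c y where x: "x = c *\<^sub>R y" "y \<in> convex hull U" "e \<bullet> x = real k"
      by (auto simp: cone_U_def)
    have "convex hull U \<subseteq> {y. e \<bullet> y = real m}"
      by (rule hull_minimal) (use height convex_hyperplane in auto)
    then have "e \<bullet> y = real m" using x by blast
    then have "c = real k / real m" using x m_pos by (simp add: field_simps)
    then show "x \<in> (\<lambda>y. (real k / real m) *\<^sub>R y) ` (convex hull U)" using x by blast
  qed
  moreover have "bounded ((\<lambda>y. (real k / real m) *\<^sub>R y) ` (convex hull U))"
    by (intro bounded_scaling bounded_convex_hull finite_imp_bounded finite_U)
  ultimately have "bounded {x \<in> cone_U. e \<bullet> x = real k}"
    by (meson bounded_subset)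
  from finite_bounded_lattice_points[OF this] show ?thesis
    by (rule rev_finite_subset) auto
qed

text \<open>Perturbing lattice points by \<open>+s\<close> or by \<open>-s\<close>, for \<open>s\<close> generic in the interior, decomposes the
  closed cone and its interior into half-open cells with complementary walls removed.\<close>
theorem reciprocity:
  assumes lattice: "U \<subseteq> lattice_points" and V: "finite V"
    and cone: "cone_U = {x. \<forall>v\<in>V. 0 \<le> v \<bullet> x}"
    and interior: "{x. \<forall>v\<in>V. 0 < v \<bullet> x} \<noteq> {}"
  obtains h h' :: "int poly" where
    "fps_of_poly h = (1 - fps_X ^ m) ^ DIM('a) * height_series e (cone_U \<inter> lattice_points)"
    "fps_of_poly h' = (1 - fps_X ^ m) ^ DIM('a) *
       height_series e ({x. \<forall>v\<in>V. 0 < v \<bullet> x} \<inter> lattice_points)"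
    "degree h \<le> DIM('a) * m" "degree h' \<le> DIM('a) * m"
    "\<And>k. k \<le> DIM('a) * m \<Longrightarrow> coeff h' k = coeff h (DIM('a) * m - k)"
proof -
  let ?Co = "{x. \<forall>v\<in>V. 0 < v \<bullet> x}" and ?N = "DIM('a) * m"
  obtain T where T: "finite T" "\<And>B. B \<in> T \<Longrightarrow> B \<subseteq> U \<and> linear_basis B"
    "\<And>x. generic U x \<Longrightarrow> card {B \<in> T. x \<in> simplicial_cone B} = (if x \<in> cone_U then 1 else 0)"
    using exists_triangulation by blast
  have "open ?Co"
    unfolding Collect_ball_eq by (intro open_INT V ballI open_halfspace_gt)
  then obtain s where s: "s \<in> ?Co" "generic U s"
    using open_contains_generic[OF finite_U _ interior] by blast
  have limp: "((\<lambda>t. v \<bullet> (x + t *\<^sub>R y)) \<longlongrightarrow> v \<bullet> x) (at_right (0::real))" for v x y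
  proof -
    have "((\<lambda>t. v \<bullet> (x + t *\<^sub>R y)) \<longlongrightarrow> v \<bullet> (x + 0 *\<^sub>R y)) (at_right (0::real))"
      by (intro tendsto_intros)
    then show ?thesis by simp
  qed
  have pert_plus: "eventually (\<lambda>t. x + t *\<^sub>R s \<in> cone_U \<longleftrightarrow> x \<in> cone_U) (at_right 0)" for x
  proof (cases "x \<in> cone_U")
    case True
    then show ?thesis
      using eventually_at_right_less[of "0::real"] s(1) unfolding cone
      by (auto elim!: eventually_mono simp: inner_add_right intro!: add_nonneg_nonneg mult_nonneg_nonneg
          intro: less_imp_le)
  next
    case False
    then obtain v where v: "v \<in> V" "v \<bullet> x < 0" by (auto simp: cone not_le)
    have "eventually (\<lambda>t. v \<bullet> (x + t *\<^sub>R s) < 0) (at_right (0::real))"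
      by (rule order_tendstoD(2)[OF limp v(2)])
    then have "eventually (\<lambda>t. x + t *\<^sub>R s \<notin> cone_U) (at_right (0::real))"
      by (rule eventually_mono) (use v in \<open>auto simp: cone not_le\<close>)
    then show ?thesis using False by simp
  qed
  have pert_minus: "eventually (\<lambda>t. x + t *\<^sub>R (- s) \<in> cone_U \<longleftrightarrow> x \<in> ?Co) (at_right 0)" for x
  proof (cases "x \<in> ?Co")
    case True
    have "eventually (\<lambda>t. \<forall>v\<in>V. 0 < v \<bullet> (x + t *\<^sub>R (- s))) (at_right (0::real))"
      by (intro eventually_ball_finite[OF V] ballI order_tendstoD(1)[OF limp]) (use True in auto)
    then show ?thesis
      by (rule eventually_mono) (use True in \<open>auto simp: cone intro: less_imp_le\<close>)
  next
    case False
    then obtain v where v: "v \<in> V" "v \<bullet> x \<le> 0" by (auto simp: not_less)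
    have "v \<bullet> (x + t *\<^sub>R (- s)) < 0" if "t > 0" for t
    proof -
      have "t * (v \<bullet> s) > 0" using s(1) v that by simp
      then show ?thesis using v by (simp add: inner_diff_right)
    qed
    then have "eventually (\<lambda>t. x + t *\<^sub>R (- s) \<notin> cone_U) (at_right (0::real))"
      using eventually_at_right_less[of "0::real"] v
      by (auto elim!: eventually_mono simp: cone not_le)
    then show ?thesis using False by (auto elim: eventually_mono)
  qed
  define I where "I B = {b\<in>B. representation B s b < 0}" for B
  have lb: "lattice_basis B e m" if "B \<in> T" for B
    using T(2)[OF that] lattice height m_pos by unfold_locales auto
  have compl: "{b\<in>B. representation B (- s) b < 0} = B - I B" if "B \<in> T" for B
    using T(2)[OF that] generic_representation_nonzero[OF s(2), of B]
    by (fastforce simp: I_def representation_uminus not_less order.strict_iff_order)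
  have Co_sub: "?Co \<subseteq> cone_U" by (auto simp: cone intro: less_imp_le)
  have count: "card {B \<in> T. x \<in> half_open_cone B (I B)} = (if x \<in> cone_U then 1 else 0)"
    if "x \<in> lattice_points" for x
    unfolding I_def by (rule half_open_decomposition[OF finite_U s(2) that T pert_plus])
  have count': "card {B \<in> T. x \<in> half_open_cone B (B - I B)} = (if x \<in> ?Co then 1 else 0)"
    if x: "x \<in> lattice_points" for x
  proof -
    have "{B \<in> T. x \<in> half_open_cone B (B - I B)}
        = {B \<in> T. x \<in> half_open_cone B {b\<in>B. representation B (- s) b < 0}}"
      by (simp add: compl cong: conj_cong)
    then show ?thesis
      using half_open_decomposition[OF finite_U generic_uminus[OF s(2)] x T pert_minus] by simp
  qed
  have F: "height_series e (cone_U \<inter> lattice_points) = (\<Sum>B\<in>T. height_series e (half_open_cone B (I B)))"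
    by (rule sum_height_series_half_open[OF T(1) finite_cone_slice count])
  have G: "height_series e (?Co \<inter> lattice_points) = (\<Sum>B\<in>T. height_series e (half_open_cone B (B - I B)))"
    by (rule sum_height_series_half_open[OF T(1) _ count'])
      (rule finite_subset[OF _ finite_cone_slice], use Co_sub in blast)
  have box: "(1 - fps_X ^ m) ^ DIM('a) * height_series e (half_open_cone B J)
      = height_series e (half_open_box B J B)" if "B \<in> T" for B J
  proof -
    interpret lattice_basis B e m by (rule lb[OF that])
    show ?thesis using height_series_box[of B J] linear_basis_card[OF basis] by simp
  qed
  have F': "(1 - fps_X ^ m) ^ DIM('a) * height_series e (cone_U \<inter> lattice_points)
      = (\<Sum>B\<in>T. height_series e (half_open_box B (I B) B))"
    unfolding F sum_distrib_left by (rule sum.cong) (auto simp: box)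
  have G': "(1 - fps_X ^ m) ^ DIM('a) * height_series e (?Co \<inter> lattice_points)
      = (\<Sum>B\<in>T. height_series e (half_open_box B (B - I B) B))"
    unfolding G sum_distrib_left by (rule sum.cong) (auto simp: box)
  have vanish: "fps_nth (\<Sum>B\<in>T. height_series e (half_open_box B (J B) B)) k = 0"
    if "k > ?N" for k :: nat and J :: "'a set \<Rightarrow> 'a set"
  proof -
    have "card {x \<in> half_open_box B (J B) B. e \<bullet> x = real k} = 0" if "B \<in> T" for B
    proof -
      interpret lattice_basis B e m by (rule lb[OF that])
      have "{x \<in> half_open_box B (J B) B. e \<bullet> x = real k} = {}"
      proof (rule ccontr)
        assume "{x \<in> half_open_box B (J B) B. e \<bullet> x = real k} \<noteq> {}"
        then have "real k \<le> real ?N" using box_height_le[of _ "J B"] by fastforce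
        then show False using \<open>k > ?N\<close> by (simp only: of_nat_le_iff)
      qed
      then show ?thesis by (simp only: card.empty)
    qed
    then show ?thesis by (simp add: fps_sum_nth)
  qed
  obtain h where h: "fps_of_poly h = (\<Sum>B\<in>T. height_series e (half_open_box B (I B) B))"
      "degree h \<le> ?N"
    using fps_of_poly_truncate[OF vanish[of _ I]] by blast
  obtain h' where h': "fps_of_poly h' = (\<Sum>B\<in>T. height_series e (half_open_box B (B - I B) B))"
      "degree h' \<le> ?N"
    using fps_of_poly_truncate[OF vanish[of _ "\<lambda>B. B - I B"]] by blast
  have "coeff h' k = coeff h (?N - k)" if k: "k \<le> ?N" for k
  proof -
    have "coeff h' k = (\<Sum>B\<in>T. int (card {x \<in> half_open_box B (B - I B) B. e \<bullet> x = real k}))"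
      using arg_cong[OF h'(1), of "\<lambda>F. fps_nth F k"] by (simp add: fps_sum_nth)
    also have "\<dots> = (\<Sum>B\<in>T. int (card {x \<in> half_open_box B (I B) B. e \<bullet> x = real (?N - k)}))"
    proof (rule sum.cong)
      fix B assume "B \<in> T"
      interpret lattice_basis B e m by (rule lb[OF \<open>B \<in> T\<close>])
      show "int (card {x \<in> half_open_box B (B - I B) B. e \<bullet> x = real k})
          = int (card {x \<in> half_open_box B (I B) B. e \<bullet> x = real (?N - k)})"
        using box_reflection[of "I B" k] k by (simp add: I_def)
    qed simp
    also have "\<dots> = coeff h (?N - k)"
      using arg_cong[OF h(1), of "\<lambda>F. fps_nth F (?N - k)"] by (simp add: fps_sum_nth)
    finally show ?thesis .
  qed
  then show ?thesis using that h h' F' G' by metis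
qed

end

section \<open>Cones with primitive facet normals\<close>

lemma bezout_finite_family:
  fixes f :: "'b \<Rightarrow> int"
  assumes "finite A"
  shows "\<exists>c. (\<Sum>a\<in>A. c a * f a) = Gcd (f ` A)"
  using assms
proof (induction A rule: finite_induct)
  case (insert x A)
  then obtain c where c: "(\<Sum>a\<in>A. c a * f a) = Gcd (f ` A)" by blast
  obtain s t where st: "s * f x + t * Gcd (f ` A) = gcd (f x) (Gcd (f ` A))"
    using bezout_int by blast
  let ?c = "\<lambda>a. if a = x then s else t * c a"
  have "(\<Sum>a\<in>insert x A. ?c a * f a) = s * f x + (\<Sum>a\<in>A. ?c a * f a)"
    using insert by simp
  also have "(\<Sum>a\<in>A. ?c a * f a) = t * Gcd (f ` A)"
    unfolding c[symmetric] sum_distrib_left by (rule sum.cong) (use insert in auto)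
  finally show ?case using st by (intro exI[of _ ?c]) simp
qed auto

lemma primitive_bezout:
  fixes v :: "'a::euclidean_space"
  assumes "primitive v"
  shows "\<exists>w\<in>lattice_points. v \<bullet> w = 1"
proof -
  obtain c where c: "(\<Sum>e\<in>Basis. c e * \<lfloor>v \<bullet> e\<rfloor>) = Gcd ((\<lambda>e::'a. \<lfloor>v \<bullet> e\<rfloor>) ` Basis)"
    using bezout_finite_family[OF finite_Basis, of "\<lambda>e. \<lfloor>v \<bullet> e\<rfloor>"] by blast
  define w where "w = (\<Sum>e::'a\<in>Basis. of_int (c e) *\<^sub>R e)"
  have w: "w \<bullet> e = of_int (c e)" if "e \<in> Basis" for e
    using that by (simp add: w_def inner_sum_left_Basis)
  have "v \<bullet> w = (\<Sum>e\<in>Basis. of_int (c e * \<lfloor>v \<bullet> e\<rfloor>))"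
    unfolding euclidean_inner[of v w]
    by (rule sum.cong) (use assms w in \<open>auto simp: primitive_def lattice_points_def elim!: Ints_cases\<close>)
  also have "\<dots> = 1"
    using assms by (simp only: flip: of_int_sum) (simp add: c primitive_def)
  finally show ?thesis
    using w by (intro bexI[of _ w]) (auto simp: lattice_points_def)
qed

lemma primitive_nonzero: "primitive v \<Longrightarrow> v \<noteq> 0"
  using primitive_bezout by fastforce

lemma primitive_multiple_unique:
  fixes u v :: "'a::euclidean_space"
  assumes "primitive u" "primitive v" "u = c *\<^sub>R v" "0 \<le> c"
  shows "u = v"
proof -
  obtain w where w: "w \<in> lattice_points" "v \<bullet> w = 1" using primitive_bezout assms(2) by blast
  obtain w' where w': "w' \<in> lattice_points" "u \<bullet> w' = 1" using primitive_bezout assms(1) by blast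
  have "c = u \<bullet> w" using w assms(3) by simp
  then have "c \<in> \<int>" using w assms(1) by (simp add: lattice_points_inner primitive_def)
  then obtain k where k: "c = of_int k" by (auto elim: Ints_cases)
  have "v \<bullet> w' \<in> \<int>" using w' assms(2) by (simp add: lattice_points_inner primitive_def)
  then obtain l where l: "v \<bullet> w' = of_int l" by (auto elim: Ints_cases)
  have "of_int (k * l) = (1::real)" using w' assms(3) k l by simp
  then have "k * l = 1" by linarith
  moreover have "k \<ge> 0" using assms(4) k by simp
  ultimately have "k = 1" by (auto simp: zmult_eq_1_iff)
  then show ?thesis using assms(3) k by simp
qed

text \<open>Scaling a ball inside the cone makes it large enough for rounding its centre.\<close>
lemma open_cone_contains_lattice_point:
  fixes S :: "'a::euclidean_space set"
  assumes "open S" "x \<in> S" and scale: "\<And>c y. c > 0 \<Longrightarrow> y \<in> S \<Longrightarrow> c *\<^sub>R y \<in> S"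
  shows "\<exists>z\<in>lattice_points. z \<in> S"
proof -
  obtain \<epsilon> where \<epsilon>: "\<epsilon> > 0" "ball x \<epsilon> \<subseteq> S" using assms by (meson open_contains_ball)
  define N where "N = real DIM('a) / \<epsilon> + 1"
  have N: "N > 0" "N * \<epsilon> > real DIM('a)"
    using \<epsilon> by (auto simp: N_def field_simps intro: add_nonneg_pos)
  define z where "z = (\<Sum>e::'a\<in>Basis. of_int \<lfloor>(N *\<^sub>R x) \<bullet> e\<rfloor> *\<^sub>R e)"
  have z: "z \<bullet> e = of_int \<lfloor>(N *\<^sub>R x) \<bullet> e\<rfloor>" if "e \<in> Basis" for e
    using that by (simp add: z_def inner_sum_left_Basis)
  have "norm (N *\<^sub>R x - z) \<le> (\<Sum>e\<in>Basis. \<bar>(N *\<^sub>R x - z) \<bullet> e\<bar>)"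
    by (rule norm_le_l1)
  also have "\<dots> \<le> (\<Sum>e::'a\<in>Basis. 1)"
  proof (rule sum_mono)
    fix e :: 'a assume "e \<in> Basis"
    then show "\<bar>(N *\<^sub>R x - z) \<bullet> e\<bar> \<le> 1"
      using z[of e] by (simp add: inner_diff_left) linarith
  qed
  finally have "norm (N *\<^sub>R x - z) < N * \<epsilon>" using N by simp
  moreover have "N *\<^sub>R x - z = N *\<^sub>R (x - (1 / N) *\<^sub>R z)"
    using N by (simp add: scaleR_diff_right)
  ultimately have "dist x ((1 / N) *\<^sub>R z) < \<epsilon>"
    using N by (simp add: dist_norm)
  then have "(1 / N) *\<^sub>R z \<in> S" using \<epsilon> by auto
  then have "N *\<^sub>R ((1 / N) *\<^sub>R z) \<in> S" by (rule scale[OF N(1)])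
  then have "z \<in> S" using N by simp
  then show ?thesis using z by (intro bexI[of _ z]) (auto simp: lattice_points_def)
qed

locale facet_cone =
  fixes V :: "'a::euclidean_space set"
  assumes finite_V: "finite V" and prim: "\<And>v. v \<in> V \<Longrightarrow> primitive v"
    and interior_point: "\<exists>s. \<forall>v\<in>V. 0 < v \<bullet> s"
    and irredundant: "\<And>v. v \<in> V \<Longrightarrow> \<exists>x. v \<bullet> x < 0 \<and> (\<forall>w\<in>V - {v}. 0 \<le> w \<bullet> x)"
begin

definition C :: "'a set" where "C = {x. \<forall>v\<in>V. 0 \<le> v \<bullet> x}"
definition Co :: "'a set" where "Co = {x. \<forall>v\<in>V. 0 < v \<bullet> x}"

lemma normal_lattice: "v \<in> V \<Longrightarrow> v \<in> lattice_points"
  using prim by (simp add: primitive_def)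

lemma open_Co: "open Co"
  unfolding Co_def Collect_ball_eq by (intro open_INT finite_V ballI open_halfspace_gt)

lemma Co_subset: "Co \<subseteq> C"
  by (auto simp: C_def Co_def intro: less_imp_le)

lemma interior_C: "interior C = Co"
proof
  show "Co \<subseteq> interior C" using open_Co Co_subset by (rule interior_maximal[rotated])
  show "interior C \<subseteq> Co"
  proof
    fix x assume x: "x \<in> interior C"
    have "0 < v \<bullet> x" if "v \<in> V" for v
    proof -
      have "interior C \<subseteq> interior {x. v \<bullet> x \<ge> 0}"
        by (rule interior_mono) (use that in \<open>auto simp: C_def\<close>)
      then show ?thesis using x primitive_nonzero[OF prim[OF that]] by auto
    qed
    then show "x \<in> Co" by (simp add: Co_def)
  qed
qed

text \<open>The points beyond the facet of \<open>v\<close> and on the positive side of all others form an open cone, nonempty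
  by irredundancy, so it contains a lattice point. A positive integral combination of that
  point with an interior lattice point lands on the facet.\<close>
lemma facet_lattice_point:
  assumes v: "v \<in> V"
  shows "\<exists>z\<in>lattice_points. v \<bullet> z = 0 \<and> (\<forall>w\<in>V - {v}. 0 < w \<bullet> z)"
proof -
  obtain s where s: "\<And>w. w \<in> V \<Longrightarrow> 0 < w \<bullet> s" using interior_point by blast
  obtain x where x: "v \<bullet> x < 0" "\<And>w. w \<in> V - {v} \<Longrightarrow> 0 \<le> w \<bullet> x" using irredundant[OF v] by blast
  define t where "t = - (v \<bullet> x) / (2 * (v \<bullet> s))"
  have t: "t > 0" using s[OF v] x by (simp add: t_def divide_less_0_iff)
  have vx: "v \<bullet> (x + t *\<^sub>R s) = (v \<bullet> x) / 2"
    unfolding inner_add_right inner_scaleR_right t_def using s[OF v] by (simp add: field_simps)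
  let ?S = "{z. v \<bullet> z < 0} \<inter> {z. \<forall>w\<in>V - {v}. 0 < w \<bullet> z}"
  have "open ?S"
    unfolding Collect_ball_eq using finite_V
    by (intro open_Int open_INT ballI open_halfspace_gt open_halfspace_lt) auto
  moreover have "x + t *\<^sub>R s \<in> ?S"
    using vx x t s by (auto simp: inner_add_right intro!: add_nonneg_pos)
  ultimately have "\<exists>z\<in>lattice_points. z \<in> ?S"
    by (rule open_cone_contains_lattice_point) (auto simp: mult_pos_neg)
  then obtain x1 where x1: "x1 \<in> lattice_points" "x1 \<in> ?S" by blast
  have "\<exists>z\<in>lattice_points. z \<in> Co"
    by (rule open_cone_contains_lattice_point[OF open_Co, of s]) (use s in \<open>auto simp: Co_def\<close>)
  then obtain s1 where s1: "s1 \<in> lattice_points" "s1 \<in> Co" by blast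
  let ?z = "(v \<bullet> s1) *\<^sub>R x1 + (- (v \<bullet> x1)) *\<^sub>R s1"
  have "?z \<in> lattice_points"
    using x1(1) s1(1) normal_lattice[OF v]
    by (intro lattice_points_add lattice_points_scaleR Ints_minus lattice_points_inner)
  moreover have "v \<bullet> ?z = 0" by (simp add: inner_diff_right)
  moreover have "0 < w \<bullet> ?z" if "w \<in> V - {v}" for w
  proof -
    have "0 < (v \<bullet> s1) * (w \<bullet> x1)" "0 < (- (v \<bullet> x1)) * (w \<bullet> s1)"
      using x1(2) s1(2) that v by (auto simp: Co_def intro!: mult_pos_pos mult_neg_pos)
    then show ?thesis by (simp add: inner_diff_right)
  qed
  ultimately show ?thesis by blast
qed

text \<open>By Bezout there is a lattice point at lattice distance one from the facet of \<open>v\<close>; adding a large multiple of a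
  point inside the facet moves it into the interior of the cone. It then lies in \<open>p + C\<close>, so \<open>v \<bullet> p \<le> 1\<close>.\<close>
lemma translate_eq_interior_iff:
  assumes p: "p \<in> lattice_points"
  shows "Co \<inter> lattice_points = (+) p ` (C \<inter> lattice_points) \<longleftrightarrow> (\<forall>v\<in>V. v \<bullet> p = 1)"
proof
  assume eq: "Co \<inter> lattice_points = (+) p ` (C \<inter> lattice_points)"
  show "\<forall>v\<in>V. v \<bullet> p = 1"
  proof
    fix v assume v: "v \<in> V"
    have "p + 0 \<in> Co \<inter> lattice_points"
      unfolding eq by (intro imageI) (auto simp: C_def lattice_points_0)
    then have "0 < v \<bullet> p" using v by (simp add: Co_def)
    moreover have "v \<bullet> p \<in> \<int>" using p v by (simp add: normal_lattice lattice_points_inner)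
    ultimately have ge: "1 \<le> v \<bullet> p" by (auto elim!: Ints_cases)
    obtain w where w: "w \<in> lattice_points" "v \<bullet> w = 1" using primitive_bezout[OF prim[OF v]] by blast
    obtain z where z: "z \<in> lattice_points" "v \<bullet> z = 0" "\<And>u. u \<in> V - {v} \<Longrightarrow> 0 < u \<bullet> z"
      using facet_lattice_point[OF v] by blast
    define N :: int where "N = 1 + (\<Sum>u\<in>V. \<lceil>\<bar>u \<bullet> w\<bar>\<rceil>)"
    have N: "\<bar>u \<bullet> w\<bar> < of_int N" if "u \<in> V" for u
    proof -
      have "\<lceil>\<bar>u \<bullet> w\<bar>\<rceil> \<le> (\<Sum>u\<in>V. \<lceil>\<bar>u \<bullet> w\<bar>\<rceil>)"
        by (rule member_le_sum) (use that finite_V in auto)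
      then show ?thesis unfolding N_def by linarith
    qed
    define q where "q = w + of_int N *\<^sub>R z"
    have qL: "q \<in> lattice_points"
      unfolding q_def by (intro lattice_points_add lattice_points_scaleR w z) auto
    have "0 < u \<bullet> q" if u: "u \<in> V" for u
    proof (cases "u = v")
      case True then show ?thesis using w z by (simp add: q_def inner_add_right)
    next
      case False
      have "0 < u \<bullet> z" using False u z by auto
      moreover have "u \<bullet> z \<in> \<int>" using u z by (simp add: normal_lattice lattice_points_inner)
      ultimately have "1 \<le> u \<bullet> z" by (auto elim!: Ints_cases)
      moreover have "0 < (of_int N :: real)" using N[OF u] by linarith
      ultimately have "of_int N * 1 \<le> of_int N * (u \<bullet> z)" by (intro mult_left_mono) auto
      then show ?thesis using N[OF u] by (simp add: q_def inner_add_right)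
    qed
    then have "q \<in> Co \<inter> lattice_points" using qL by (simp add: Co_def)
    then obtain x where "x \<in> C" "q = p + x" unfolding eq by blast
    then have "v \<bullet> p \<le> v \<bullet> q" using v by (simp add: C_def inner_add_right)
    also have "v \<bullet> q = 1" using w z by (simp add: q_def inner_add_right)
    finally show "v \<bullet> p = 1" using ge by simp
  qed
next
  assume one: "\<forall>v\<in>V. v \<bullet> p = 1"
  show "Co \<inter> lattice_points = (+) p ` (C \<inter> lattice_points)"
  proof (intro equalityI subsetI)
    fix z assume z: "z \<in> Co \<inter> lattice_points"
    have "0 \<le> v \<bullet> (z - p)" if "v \<in> V" for v
    proof -
      have "v \<bullet> z \<in> \<int>" "0 < v \<bullet> z"
        using z that by (auto simp: Co_def normal_lattice lattice_points_inner)
      then have "1 \<le> v \<bullet> z" by (auto elim!: Ints_cases)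
      then show ?thesis using one that by (simp add: inner_diff_right)
    qed
    then have "z - p \<in> C \<inter> lattice_points" using z p by (auto simp: C_def lattice_points_diff)
    then show "z \<in> (+) p ` (C \<inter> lattice_points)" by (rule rev_image_eqI) simp
  next
    fix z assume "z \<in> (+) p ` (C \<inter> lattice_points)"
    then show "z \<in> Co \<inter> lattice_points"
      using one p by (auto simp: Co_def C_def inner_add_right lattice_points_add intro!: add_pos_nonneg)
  qed
qed

text \<open>Farkas: a vector outside the closed cone over \<open>V\<close> is separated from it by a functional, which is a point
  of \<open>C\<close>.\<close>
lemma dual_cone_eq: "dual_cone C = convex_cone hull V"
proof (intro equalityI subsetI)
  fix u assume u: "u \<in> dual_cone C"
  show "u \<in> convex_cone hull V"
  proof (rule ccontr)
    assume "u \<notin> convex_cone hull V"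
    then obtain a b where ab: "a \<bullet> u < b" "\<And>x. x \<in> convex_cone hull V \<Longrightarrow> b < a \<bullet> x"
      using separating_hyperplane_closed_point[OF convex_convex_cone_hull closed_convex_cone_hull[OF finite_V]]
      by blast
    have b: "b < 0" using ab(2)[OF convex_cone_hull_contains_0] by simp
    have "0 \<le> v \<bullet> a" if "v \<in> V" for v
    proof (rule ccontr)
      assume neg: "\<not> 0 \<le> v \<bullet> a"
      have "(b / (v \<bullet> a)) *\<^sub>R v \<in> convex_cone hull V"
        using b neg that by (intro convex_cone_hull_mul hull_inc) (auto simp: divide_nonpos_neg)
      then have "b < (b / (v \<bullet> a)) * (a \<bullet> v)" using ab(2) by force
      then show False using neg by (simp add: inner_commute)
    qed
    then have "a \<in> C" by (simp add: C_def)
    then have "0 \<le> u \<bullet> a" using u by (simp add: dual_cone_def)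
    then show False using ab(1) b by (simp add: inner_commute)
  qed
next
  have "V \<subseteq> dual_cone C" by (auto simp: dual_cone_def C_def)
  moreover have "convex_cone (dual_cone C)"
    by (auto simp: convex_cone_def conic_def convex_def dual_cone_def inner_add_left intro: exI[of _ 0])
  ultimately have "convex_cone hull V \<subseteq> dual_cone C" by (rule hull_minimal)
  then show "\<And>u. u \<in> convex_cone hull V \<Longrightarrow> u \<in> dual_cone C" by blast
qed

text \<open>From \<open>z\<close> inside the facet of \<open>v\<close> one can move in every direction orthogonal to \<open>v\<close> without leaving
  \<open>C\<close>, so a dual vector vanishing at \<open>z\<close> vanishes on the whole hyperplane.\<close>
lemma dual_cone_facet_ray:
  assumes v: "v \<in> V" and z: "v \<bullet> z = 0" "\<And>w. w \<in> V - {v} \<Longrightarrow> 0 < w \<bullet> z"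
    and a: "a \<in> dual_cone C" "a \<bullet> z = 0"
  shows "\<exists>c\<ge>0. a = c *\<^sub>R v"
proof -
  have nonneg: "0 \<le> a \<bullet> y" if y: "v \<bullet> y = 0" for y
  proof -
    have "eventually (\<lambda>t. \<forall>w\<in>V. 0 \<le> w \<bullet> (z + t *\<^sub>R y)) (at_right (0::real))"
    proof (intro eventually_ball_finite finite_V ballI)
      fix w assume w: "w \<in> V"
      show "eventually (\<lambda>t. 0 \<le> w \<bullet> (z + t *\<^sub>R y)) (at_right (0::real))"
      proof (cases "w = v")
        case True then show ?thesis using y z by (simp add: inner_add_right)
      next
        case False
        have "((\<lambda>t. w \<bullet> (z + t *\<^sub>R y)) \<longlongrightarrow> w \<bullet> (z + 0 *\<^sub>R y)) (at_right (0::real))"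
          by (intro tendsto_intros)
        then have "((\<lambda>t. w \<bullet> (z + t *\<^sub>R y)) \<longlongrightarrow> w \<bullet> z) (at_right (0::real))" by simp
        from order_tendstoD(1)[OF this, of 0] show ?thesis
          using z(2) w False by (auto elim!: eventually_mono intro: less_imp_le)
      qed
    qed
    then have "eventually (\<lambda>t. t > 0 \<and> (\<forall>w\<in>V. 0 \<le> w \<bullet> (z + t *\<^sub>R y))) (at_right (0::real))"
      using eventually_at_right_less[of "0::real"] by (simp add: eventually_conj_iff)
    then obtain t :: real where t: "t > 0" "\<forall>w\<in>V. 0 \<le> w \<bullet> (z + t *\<^sub>R y)"
      using eventually_happens[of _ "at_right (0::real)"] by (auto simp: trivial_limit_at_right_real)
    then have "z + t *\<^sub>R y \<in> C" unfolding C_def by blast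
    then have "0 \<le> a \<bullet> (z + t *\<^sub>R y)" using a(1) unfolding dual_cone_def by blast
    then show ?thesis using a(2) t(1) by (simp add: inner_add_right zero_le_mult_iff)
  qed
  have "v \<noteq> 0" using prim v primitive_nonzero by blast
  define c where "c = (a \<bullet> v) / (v \<bullet> v)"
  have vy: "v \<bullet> (a - c *\<^sub>R v) = 0"
    using \<open>v \<noteq> 0\<close> by (simp add: c_def inner_diff_right inner_commute)
  have "a \<bullet> (a - c *\<^sub>R v) = 0"
    using nonneg[OF vy] nonneg[of "- (a - c *\<^sub>R v)"] vy by (simp add: inner_diff_right)
  then have "(a - c *\<^sub>R v) \<bullet> (a - c *\<^sub>R v) = 0"
    using vy by (simp add: inner_diff_left)
  then have ac: "a = c *\<^sub>R v" by simp
  obtain s where s: "\<And>w. w \<in> V \<Longrightarrow> 0 < w \<bullet> s" using interior_point by blast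
  then have "s \<in> C" by (auto simp: C_def intro: less_imp_le)
  then have "0 \<le> a \<bullet> s" using a(1) by (simp add: dual_cone_def)
  then have "0 \<le> c" using ac s[OF v] by (simp add: zero_le_mult_iff)
  then show ?thesis using ac by blast
qed

text \<open>The ray of a normal is the face of the dual cone cut out by a point inside its facet. Conversely, a
  generator of a ray face is a nonnegative combination of normals; the face property puts a normal
  with positive coefficient on that ray, and primitive vectors on one ray agree.\<close>
theorem primitive_ray_generator_dual_iff:
  "primitive_ray_generator (dual_cone C) u \<longleftrightarrow> u \<in> V"
proof
  assume v: "u \<in> V"
  obtain z where z: "z \<in> lattice_points" "u \<bullet> z = 0" "\<And>w. w \<in> V - {u} \<Longrightarrow> 0 < w \<bullet> z"
    using facet_lattice_point[OF v] by blast
  have zC: "z \<in> C" using z unfolding C_def by (force intro: less_imp_le)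
  have "{c *\<^sub>R u |c. 0 \<le> c} face_of dual_cone C"
    unfolding face_of_def
  proof (intro conjI ballI impI)
    show "{c *\<^sub>R u |c. 0 \<le> c} \<subseteq> dual_cone C"
      using v by (auto simp: dual_cone_def C_def)
    show "convex {c *\<^sub>R u |c. 0 \<le> c}"
    proof (rule convexI)
      fix x y and s t :: real
      assume *: "x \<in> {c *\<^sub>R u |c. 0 \<le> c}" "y \<in> {c *\<^sub>R u |c. 0 \<le> c}" "0 \<le> s" "0 \<le> t" "s + t = 1"
      then obtain c d where "x = c *\<^sub>R u" "y = d *\<^sub>R u" "0 \<le> c" "0 \<le> d" by blast
      then show "s *\<^sub>R x + t *\<^sub>R y \<in> {c *\<^sub>R u |c. 0 \<le> c}"
        using * by (intro CollectI exI[of _ "s * c + t * d"]) (simp add: scaleR_left_distrib)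
    qed
    fix a b x assume ab: "a \<in> dual_cone C" "b \<in> dual_cone C" and x: "x \<in> {c *\<^sub>R u |c. 0 \<le> c}"
      and seg: "x \<in> open_segment a b"
    obtain t where t: "0 < t" "t < 1" "x = (1 - t) *\<^sub>R a + t *\<^sub>R b"
      using seg by (auto simp: in_segment)
    have "x \<bullet> z = 0" using x z(2) by auto
    then have sum0: "(1 - t) * (a \<bullet> z) + t * (b \<bullet> z) = 0" using t by (simp add: inner_add_left)
    have nn: "0 \<le> a \<bullet> z" "0 \<le> b \<bullet> z" using ab zC by (auto simp: dual_cone_def)
    then have "0 \<le> (1 - t) * (a \<bullet> z)" "0 \<le> t * (b \<bullet> z)" using t by auto
    then have "(1 - t) * (a \<bullet> z) = 0" "t * (b \<bullet> z) = 0" using sum0 by linarith+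
    then have "a \<bullet> z = 0" "b \<bullet> z = 0" using t by auto
    then show "a \<in> {c *\<^sub>R u |c. 0 \<le> c}" "b \<in> {c *\<^sub>R u |c. 0 \<le> c}"
      using dual_cone_facet_ray[OF v z(2,3)] ab by blast+
  qed
  then show "primitive_ray_generator (dual_cone C) u"
    using prim[OF v] by (simp add: primitive_ray_generator_def)
next
  assume "primitive_ray_generator (dual_cone C) u"
  then have pu: "primitive u" and face: "{c *\<^sub>R u |c. 0 \<le> c} face_of dual_cone C"
    by (auto simp: primitive_ray_generator_def)
  have "1 *\<^sub>R u \<in> {c *\<^sub>R u |c. 0 \<le> c}" by (intro CollectI exI[of _ 1]) simp
  then have u_ray: "u \<in> {c *\<^sub>R u |c. 0 \<le> c}" by simp
  then have ud: "u \<in> dual_cone C" using face face_of_imp_subset by blast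
  have "u \<noteq> 0" using pu primitive_nonzero by blast
  have "u \<in> insert 0 (\<Union>x\<in>convex hull V. \<Union>c\<in>{0..}. {c *\<^sub>R x})"
    using ud unfolding dual_cone_eq convex_cone_hull_convex_hull .
  then obtain x c where xc: "x \<in> convex hull V" "c \<ge> 0" "u = c *\<^sub>R x" using \<open>u \<noteq> 0\<close> by auto
  obtain f where f: "\<forall>v\<in>V. 0 \<le> f v" "(\<Sum>v\<in>V. f v *\<^sub>R v) = x"
    using xc(1) by (auto simp: convex_hull_finite[OF finite_V])
  define \<mu> where "\<mu> v = c * f v" for v
  have \<mu>: "\<And>v. v \<in> V \<Longrightarrow> 0 \<le> \<mu> v" "(\<Sum>v\<in>V. \<mu> v *\<^sub>R v) = u"
    using f xc by (auto simp: \<mu>_def scaleR_sum_right)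
  obtain v where v: "v \<in> V" "\<mu> v \<noteq> 0"
  proof (rule ccontr)
    assume "\<not> thesis"
    then have "\<And>v. v \<in> V \<Longrightarrow> \<mu> v *\<^sub>R v = 0" using that by force
    then have "(\<Sum>v\<in>V. \<mu> v *\<^sub>R v) = 0" by (rule sum.neutral[OF ballI])
    then show False using \<mu>(2) \<open>u \<noteq> 0\<close> by simp
  qed
  then have mpos: "\<mu> v > 0" using \<mu>(1)[of v] by simp
  let ?a = "(2 * \<mu> v) *\<^sub>R v" and ?b = "2 *\<^sub>R (\<Sum>w\<in>V - {v}. \<mu> w *\<^sub>R w)"
  have split: "u = \<mu> v *\<^sub>R v + (\<Sum>w\<in>V - {v}. \<mu> w *\<^sub>R w)"
    using sum.remove[OF finite_V v(1), of "\<lambda>v. \<mu> v *\<^sub>R v"] \<mu>(2) by simp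
  have mid: "u = (1 - 1/2) *\<^sub>R ?a + (1/2::real) *\<^sub>R ?b"
    by (subst split) (simp add: algebra_simps)
  have Vd: "v \<bullet> x \<ge> 0" if "v \<in> V" "x \<in> C" for v x using that by (simp add: C_def)
  have ad: "?a \<in> dual_cone C" using v mpos Vd by (auto simp: dual_cone_def)
  have bd: "?b \<in> dual_cone C"
    using \<mu>(1) Vd by (auto simp: dual_cone_def inner_sum_left intro!: sum_nonneg)
  have "?a \<in> {c *\<^sub>R u |c. 0 \<le> c}"
  proof (cases "?a = ?b")
    case True
    then have "u = (1 - 1/2) *\<^sub>R ?a + (1/2::real) *\<^sub>R ?a" using mid by simp
    then have "u = ?a" by (simp flip: scaleR_left_distrib)
    then show ?thesis using u_ray by simp
  next
    case False
    then have "u \<in> open_segment ?a ?b"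
      unfolding in_segment using mid by (intro conjI exI[of _ "1/2"]) auto
    then show ?thesis using face ad bd u_ray unfolding face_of_def by blast
  qed
  then obtain c' where c': "c' \<ge> 0" "(2 * \<mu> v) *\<^sub>R v = c' *\<^sub>R u" by auto
  have "v = (1 / (2 * \<mu> v)) *\<^sub>R ((2 * \<mu> v) *\<^sub>R v)" using mpos by simp
  also have "\<dots> = (c' / (2 * \<mu> v)) *\<^sub>R u" by (simp add: c')
  finally have "v = u"
    by (rule primitive_multiple_unique[OF prim[OF v(1)] pu]) (use c' mpos in simp)
  then show "u \<in> V" using v by simp
qed

end

section \<open>Palindromic numerators\<close>

lemma to_fract_power: "to_fract (x ^ k) = to_fract x ^ k" for x :: "int poly"
  by (induction k) auto

lemma to_fract_sum: "to_fract (\<Sum>k\<in>A. f k) = (\<Sum>k\<in>A. to_fract (f k))" for f :: "'b \<Rightarrow> int poly"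
  by (induction A rule: infinite_finite_induct) auto

lemma to_fract_monom: "to_fract (monom c k) = of_int c * ratfun_X ^ k" for c :: int
  by (simp add: of_int_fract monom_altdef flip: to_fract_power to_fract_mult)

lemma poly_at_recip_reflect:
  assumes deg: "degree p \<le> N" "degree q \<le> N"
    and coeffs: "\<And>k. k \<le> N \<Longrightarrow> coeff q k = coeff p (N - k)"
  shows "ratfun_X ^ N * poly_at_recip p = to_fract q"
proof -
  have X0: "ratfun_X \<noteq> 0" by simp
  have "degree (map_poly of_int p :: int poly fract poly) \<le> N"
    using deg(1) by (intro degree_le) (auto simp: coeff_map_poly coeff_eq_0)
  then have pp: "poly_at_recip p = (\<Sum>k\<le>N. of_int (coeff p k) * (1 / ratfun_X) ^ k)"
    unfolding poly_at_recip_def poly_altdef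
    by (intro sum.mono_neutral_cong_left) (auto simp: coeff_map_poly of_int_fract coeff_eq_0 intro!: le_degree)
  have "ratfun_X ^ N * poly_at_recip p = (\<Sum>k\<le>N. of_int (coeff p k) * ratfun_X ^ (N - k))"
    unfolding pp sum_distrib_left
    by (rule sum.cong) (use X0 in \<open>auto simp: power_divide power_diff\<close>)
  also have "\<dots> = (\<Sum>k\<le>N. of_int (coeff q k) * ratfun_X ^ k)"
    by (rule sum.reindex_bij_witness[of _ "\<lambda>k. N - k" "\<lambda>k. N - k"]) (auto simp: coeffs)
  also have "\<dots> = to_fract (\<Sum>k\<le>N. monom (coeff q k) k)"
    by (simp add: to_fract_sum to_fract_monom)
  also have "(\<Sum>k\<le>N. monom (coeff q k) k) = q"
    by (rule poly_as_sum_of_monoms'[OF deg(2)])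
  finally show ?thesis .
qed

lemma poly_at_recip_power: "poly_at_recip (p ^ k) = poly_at_recip p ^ k"
  by (induction k) (simp_all add: poly_at_recip_mult, simp add: poly_at_recip_def)

lemma poly_at_recip_one_minus_power:
  fixes m D :: nat
  assumes "m > 0"
  shows "ratfun_X ^ (D * m) * poly_at_recip ((1 - monom 1 m) ^ D)
    = (- 1) ^ D * to_fract ((1 - monom 1 m) ^ D)"
proof -
  have "ratfun_X ^ m * poly_at_recip (1 - monom 1 m) = to_fract (monom 1 m - 1)"
  proof (rule poly_at_recip_reflect)
    show "degree (1 - monom 1 m :: int poly) \<le> m" "degree (monom 1 m - 1 :: int poly) \<le> m"
      by (auto intro!: degree_diff_le degree_monom_le)
    show "coeff (monom 1 m - 1) k = coeff (1 - monom 1 m :: int poly) (m - k)" if "k \<le> m" for k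
      using that assms by (auto simp: coeff_1)
  qed
  also have "\<dots> = - to_fract (1 - monom 1 m)"
    by (simp flip: to_fract_uminus)
  finally have *: "ratfun_X ^ m * poly_at_recip (1 - monom 1 m) = - to_fract (1 - monom 1 m)" .
  have "ratfun_X ^ (D * m) * poly_at_recip ((1 - monom 1 m) ^ D)
      = (ratfun_X ^ m * poly_at_recip (1 - monom 1 m)) ^ D"
    by (simp add: poly_at_recip_power power_mult_distrib mult.commute[of D] flip: power_mult)
  also have "\<dots> = (- 1) ^ D * to_fract ((1 - monom 1 m) ^ D)"
    unfolding * by (metis mult_minus1 power_mult_distrib to_fract_power)
  finally show ?thesis .
qed

text \<open>The series \<open>F\<close> and \<open>G\<close> share the denominator \<open>(1 - X\<^sup>m)\<^sup>D\<close>, and their numerators are the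
  reverses of each other at degree \<open>D m\<close>. Hence \<open>F(1/X) = (-1)\<^sup>D G(X)\<close> as rational functions.\<close>
locale reciprocal_numerators =
  fixes F G :: "int fps" and h h' :: "int poly" and m D :: nat
  assumes m: "m > 0"
    and h: "fps_of_poly h = (1 - fps_X ^ m) ^ D * F"
    and h': "fps_of_poly h' = (1 - fps_X ^ m) ^ D * G"
    and degree: "degree h \<le> D * m" "degree h' \<le> D * m"
    and reflect: "\<And>k. k \<le> D * m \<Longrightarrow> coeff h' k = coeff h (D * m - k)"
begin

abbreviation "denom \<equiv> (1 - monom 1 m :: int poly) ^ D"

lemma denom_nonzero: "denom \<noteq> 0"
proof -
  have "coeff (1 - monom 1 m :: int poly) 0 = 1" using m by simp
  then have "(1 - monom 1 m :: int poly) \<noteq> 0" by (metis coeff_0 zero_neq_one)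
  then show ?thesis by simp
qed

lemma fps_of_denom: "fps_of_poly denom = (1 - fps_X ^ m) ^ D"
  by (simp add: fps_of_poly_power fps_of_poly_diff fps_of_poly_monom)

lemma reciprocal_h: "ratfun_X ^ (D * m) * poly_at_recip h = to_fract h'"
  by (rule poly_at_recip_reflect[OF degree reflect])

lemma shift_iff: "ratfun_X ^ g * to_fract h = to_fract h' \<longleftrightarrow> fps_X ^ g * F = G"
proof -
  have "ratfun_X ^ g * to_fract h = to_fract h' \<longleftrightarrow> to_fract (monom 1 g * h) = to_fract h'"
    using to_fract_monom[of 1 g] by simp
  also have "\<dots> \<longleftrightarrow> monom 1 g * h = h'" by (simp del: to_fract_mult)
  also have "\<dots> \<longleftrightarrow> fps_of_poly (monom 1 g * h) = fps_of_poly h'"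
    by (simp add: fps_of_poly_eq_iff)
  also have "\<dots> \<longleftrightarrow> fps_of_poly denom * (fps_X ^ g * F) = fps_of_poly denom * G"
    by (simp add: fps_of_poly_mult fps_of_poly_monom h h' fps_of_denom mult_ac)
  also have "\<dots> \<longleftrightarrow> fps_X ^ g * F = G"
  proof -
    have "fps_of_poly denom \<noteq> 0"
      using denom_nonzero fps_of_poly_eq_iff[of denom 0] by (simp only: fps_of_poly_0) simp
    then show ?thesis by (simp only: mult_cancel_left simp_thms)
  qed
  finally show ?thesis .
qed

lemma numerator_palindromic_iff:
  "ratfun_X powi (int (D * m) - int g) * at_recip (to_fract h) = to_fract h
     \<longleftrightarrow> fps_X ^ g * F = G"
proof -
  have X0: "ratfun_X \<noteq> 0" by simp
  have one: "poly_at_recip 1 = 1" by (simp add: poly_at_recip_def)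
  have "at_recip (to_fract h) = poly_at_recip h"
    using at_recip_Fract[of 1 h] by (simp add: to_fract_def one)
  moreover have "ratfun_X powi (int (D * m) - int g) = ratfun_X ^ (D * m) / ratfun_X ^ g"
    using X0 by (simp add: power_int_diff del: of_nat_mult)
  ultimately have "ratfun_X powi (int (D * m) - int g) * at_recip (to_fract h) = to_fract h' / ratfun_X ^ g"
    by (simp flip: reciprocal_h)
  also have "\<dots> = to_fract h \<longleftrightarrow> ratfun_X ^ g * to_fract h = to_fract h'"
    using X0 by (auto simp: field_simps)
  finally show ?thesis by (simp add: shift_iff)
qed

lemma ratfun_reciprocal_iff:
  "(- 1) ^ D * ratfun_X ^ g * ratfun_of_fps F = at_recip (ratfun_of_fps F) \<longleftrightarrow> fps_X ^ g * F = G"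
proof -
  define Q where "Q = to_fract denom"
  have X0: "ratfun_X \<noteq> 0" and Q0: "Q \<noteq> 0" using denom_nonzero by (auto simp: Q_def)
  have F: "ratfun_of_fps F = Fract h denom"
    by (rule ratfun_of_fps_eqI[OF denom_nonzero]) (simp add: fps_of_denom h)
  have "at_recip (ratfun_of_fps F) = poly_at_recip h / poly_at_recip denom"
    unfolding F by (rule at_recip_Fract[OF denom_nonzero])
  also have "\<dots> = (ratfun_X ^ (D * m) * poly_at_recip h) / (ratfun_X ^ (D * m) * poly_at_recip denom)"
    using X0 by simp
  also have "\<dots> = to_fract h' / ((- 1) ^ D * Q)"
    unfolding reciprocal_h poly_at_recip_one_minus_power[OF m] Q_def ..
  also have "\<dots> = (- 1) ^ D * (to_fract h' / Q)"
    by (cases "even D") auto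
  finally have "at_recip (ratfun_of_fps F) = (- 1) ^ D * (to_fract h' / Q)" .
  moreover have "ratfun_of_fps F = to_fract h / Q"
    unfolding F Q_def by (simp add: Fract_conv_to_fract)
  moreover have "(- 1) ^ D * ratfun_X ^ g * (to_fract h / Q) = (- 1) ^ D * (to_fract h' / Q)
      \<longleftrightarrow> ratfun_X ^ g * to_fract h = to_fract h'"
    using Q0 by (cases "even D") auto
  ultimately show ?thesis by (simp only: shift_iff)
qed

end

section \<open>Counting functions of Gorenstein cones\<close>

locale graded_cone = homogeneous_generators U e m + facet_cone V
  for U V :: "'a::euclidean_space set" and e :: 'a and m :: nat +
  assumes cone_U_eq: "cone_U = C" and U_lattice: "U \<subseteq> lattice_points"
    and e_lattice: "e \<in> lattice_points" and dim_ge_2: "DIM('a) \<ge> 2"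
begin

abbreviation "slice k \<equiv> {x \<in> C \<inter> lattice_points. e \<bullet> x = real k}"
abbreviation "open_slice k \<equiv> {x \<in> Co \<inter> lattice_points. e \<bullet> x = real k}"

lemma finite_slice: "finite (slice k)"
  using finite_cone_slice[of k] by (simp add: cone_U_eq)

lemma finite_open_slice: "finite (open_slice k)"
  by (rule finite_subset[OF _ finite_slice[of k]]) (use Co_subset in blast)

lemma height_convex_hull: "y \<in> convex hull U \<Longrightarrow> e \<bullet> y = real m"
proof -
  have "convex hull U \<subseteq> {y. e \<bullet> y = real m}"
    by (rule hull_minimal) (use height convex_hyperplane in auto)
  then show "y \<in> convex hull U \<Longrightarrow> e \<bullet> y = real m" by blast
qed

lemma height_nonneg: "x \<in> C \<Longrightarrow> 0 \<le> e \<bullet> x"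
  unfolding cone_U_eq[symmetric] cone_U_def by (auto simp: height_convex_hull)

lemma height_0: "x \<in> C \<Longrightarrow> e \<bullet> x = 0 \<Longrightarrow> x = 0"
  unfolding cone_U_eq[symmetric] cone_U_def using m_pos by (auto simp: height_convex_hull)

lemma height_nat:
  assumes "x \<in> C \<inter> lattice_points"
  obtains k where "e \<bullet> x = real k"
proof -
  have "e \<bullet> x \<in> \<int>" using assms e_lattice by (simp add: lattice_points_inner)
  then have "e \<bullet> x \<in> \<nat>" using assms height_nonneg by (simp add: Nats_altdef2)
  then show ?thesis using that by (auto elim: Nats_cases)
qed

lemma slice_0: "slice 0 = {0}"
  using height_0 by (auto simp: C_def lattice_points_0)

lemma C_pointed: "x \<in> C \<Longrightarrow> - x \<in> C \<Longrightarrow> x = 0"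
  using height_0[of x] height_nonneg[of x] height_nonneg[of "- x"] by simp

lemma Co_add: "x \<in> Co \<Longrightarrow> y \<in> C \<Longrightarrow> x + y \<in> Co"
  by (auto simp: Co_def C_def inner_add_right intro: add_pos_nonneg)

text \<open>Multiples of two generators give two lattice points of \<open>C\<close> at every positive height divisible by \<open>m\<close>.\<close>
lemma card_U_ge_2: "card U \<ge> 2"
proof -
  have "Co \<noteq> {}" using interior_point by (auto simp: Co_def)
  then obtain s where s: "s \<in> Co" "generic U s" using open_contains_generic[OF finite_U open_Co] by blast
  then have "s \<in> cone_U" using Co_subset cone_U_eq by blast
  then have "s \<in> span U"
    using convex_hull_subset_span by (force simp: cone_U_def intro: span_scale)
  then have "span U = UNIV" using s(2) unfolding generic_def by blast
  then have "dim U = DIM('a)" by (simp add: dim_eq_full)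
  then show ?thesis using dim_ge_2 dim_le_card'[OF finite_U] by simp
qed

lemma translate_imp_series:
  assumes p: "p \<in> lattice_points" "e \<bullet> p = real g"
    and eq: "Co \<inter> lattice_points = (+) p ` (C \<inter> lattice_points)"
  shows "fps_X ^ g * height_series e (C \<inter> lattice_points) = height_series e (Co \<inter> lattice_points)"
proof (rule fps_ext)
  fix k
  show "fps_nth (fps_X ^ g * height_series e (C \<inter> lattice_points)) k
      = fps_nth (height_series e (Co \<inter> lattice_points)) k"
  proof (cases "k < g")
    case True
    have "open_slice k = {}"
    proof (rule ccontr)
      assume "open_slice k \<noteq> {}"
      then obtain x where x: "x \<in> C" "e \<bullet> (p + x) = real k" unfolding eq by blast
      then have "real g \<le> real k" using p height_nonneg[OF x(1)] by (simp add: inner_add_right)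
      then show False using True by simp
    qed
    then show ?thesis using True
      by (simp only: fps_X_power_mult_nth height_series_nth card.empty if_True of_nat_0)
  next
    case False
    then have "open_slice k = (+) p ` slice (k - g)"
      unfolding eq using p by (auto simp: inner_add_right of_nat_diff)
    then have "card (open_slice k) = card (slice (k - g))"
      by (simp add: card_image)
    then show ?thesis using False by (simp add: fps_X_power_mult_nth)
  qed
qed

text \<open>Equality of counts gives a unique interior lattice point \<open>p\<close> of height \<open>g\<close>. Translation by \<open>p\<close> is then a
  bijection in all heights \<open>\<ge> g\<close>. An interior point of smaller height would bound the number of
  lattice points of \<open>C\<close> along an arithmetic progression of heights.\<close>
lemma equal_counts_imp_translate:
  assumes counts: "\<And>k. card (slice k) = card (open_slice (k + g))"
  obtains p where "p \<in> lattice_points" "e \<bullet> p = real g"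
    "Co \<inter> lattice_points = (+) p ` (C \<inter> lattice_points)"
proof -
  have "card (open_slice g) = 1" using counts[of 0] unfolding slice_0 by simp
  then obtain p where "open_slice g = {p}" by (rule card_1_singletonE)
  then have p: "p \<in> Co" "p \<in> lattice_points" "e \<bullet> p = real g" by blast+
  have translate: "(+) q ` slice k \<subseteq> open_slice (k + h)"
    if "q \<in> Co" "q \<in> lattice_points" "e \<bullet> q = real h" for q k h
    using that by (auto simp: Co_add lattice_points_add inner_add_right)
  have eq: "(+) p ` slice k = open_slice (k + g)" for k
    by (rule card_subset_eq[OF finite_open_slice translate[OF p]]) (simp only: card_image[OF inj_on_add] counts)
  have low: "g \<le> h" if q: "q \<in> Co" "q \<in> lattice_points" "e \<bullet> q = real h" for q h
  proof (rule ccontr)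
    assume "\<not> g \<le> h"
    define l where "l = g - h"
    have l: "l > 0" "l + h = g" using \<open>\<not> g \<le> h\<close> by (auto simp: l_def)
    have step: "card (slice (k + l)) \<le> card (slice k)" for k
    proof -
      have "card (slice (k + l)) = card ((+) q ` slice (k + l))" by (simp add: card_image)
      also have "\<dots> \<le> card (open_slice (k + l + h))"
        by (rule card_mono[OF finite_open_slice translate[OF q]])
      also have "\<dots> = card (slice k)" using counts[of k] l by (simp add: add.assoc)
      finally show ?thesis .
    qed
    \<comment> \<open>Height \<open>0\<close> contains only the origin; height \<open>m l\<close> contains \<open>l u\<close> for every generator \<open>u\<close>.\<close>
    have bound: "card (slice (j * l)) \<le> 1" for j
    proof (induction j)
      case 0
      then show ?case using slice_0 by simp
    next
      case (Suc j)
      then show ?case using step[of "j * l"] by (simp add: add.commute)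
    qed
    have "(\<lambda>u. real l *\<^sub>R u) ` U \<subseteq> slice (m * l)"
    proof
      fix x assume "x \<in> (\<lambda>u. real l *\<^sub>R u) ` U"
      then obtain u where u: "u \<in> U" "x = real l *\<^sub>R u" by blast
      have "x \<in> cone_U" using u hull_inc[of u U convex]
        unfolding cone_U_def by (intro CollectI exI[of _ "real l"] exI[of _ u]) simp
      then show "x \<in> slice (m * l)"
        using u U_lattice height by (auto simp: cone_U_eq lattice_points_scaleR mult.commute)
    qed
    then have "card ((\<lambda>u. real l *\<^sub>R u) ` U) \<le> 1"
      using bound[of m] card_mono[OF finite_slice[of "m * l"]] by (meson order_trans)
    moreover have "card ((\<lambda>u. real l *\<^sub>R u) ` U) = card U"
      by (rule card_image) (use l in \<open>auto simp: inj_on_def\<close>)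
    ultimately show False using card_U_ge_2 by simp
  qed
  have "Co \<inter> lattice_points \<subseteq> (+) p ` (C \<inter> lattice_points)"
  proof
    fix z assume z: "z \<in> Co \<inter> lattice_points"
    then have "z \<in> C \<inter> lattice_points" using Co_subset by blast
    then obtain h where h: "e \<bullet> z = real h" by (rule height_nat)
    then have "g \<le> h" using low z by blast
    then have "z \<in> open_slice ((h - g) + g)" using z h by simp
    then show "z \<in> (+) p ` (C \<inter> lattice_points)" unfolding eq[symmetric] by blast
  qed
  moreover have "(+) p ` (C \<inter> lattice_points) \<subseteq> Co \<inter> lattice_points"
    using p by (auto simp: Co_add lattice_points_add)
  ultimately show ?thesis using that p by blast
qed

lemma gorenstein_iff:
  assumes "p \<in> lattice_points"
  shows "Gorenstein_cone_with_point C p \<longleftrightarrow> (\<forall>v\<in>V. v \<bullet> p = 1)"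
proof -
  have "U \<noteq> {}" using card_U_ge_2 by auto
  then have "C = convex_cone hull U"
    unfolding cone_U_eq[symmetric] cone_U_def by (subst convex_cone_hull_convex_hull_nonempty) auto
  moreover have "U \<subseteq> rational_points"
    using U_lattice Ints_subset_Rats by (auto simp: lattice_points_def rational_points_def)
  ultimately have rat: "rational_cone C"
    using finite_U by (auto simp: rational_cone_def)
  have pointed: "pointed C"
  proof -
    have "0 \<in> C" by (simp add: C_def)
    then show ?thesis using C_pointed by (auto simp: pointed_def)
  qed
  have "interior C \<noteq> {}" using interior_point by (auto simp: interior_C Co_def)
  then have dim: "aff_dim C = int DIM('a)" by (rule aff_dim_nonempty_interior)
  have "p \<in> C" if "\<forall>v\<in>V. v \<bullet> p = 1" using that by (simp add: C_def)
  then show ?thesis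
    using assms rat pointed dim translate_eq_interior_iff[OF assms]
    by (auto simp: Gorenstein_cone_with_point_def interior_C)
qed

lemma normals_separate:
  assumes "\<And>v. v \<in> V \<Longrightarrow> v \<bullet> p = v \<bullet> q"
  shows "p = q"
proof -
  have "p - q \<in> C" "- (p - q) \<in> C" using assms by (auto simp: C_def inner_diff_right)
  then have "p - q = 0" by (rule C_pointed)
  then show ?thesis by simp
qed

end

section \<open>The cone over a rational polytope\<close>

lemma lattice_points_vec_iff: "x \<in> lattice_points \<longleftrightarrow> (\<forall>k. x $ k \<in> \<int>)" for x :: "real ^ 'd"
  by (auto simp: lattice_points_def Basis_vec_def inner_axis)

lemma lattice_points_Pair_iff:
  "(c, x) \<in> lattice_points \<longleftrightarrow> c \<in> \<int> \<and> x \<in> lattice_points" for c :: real and x :: "'a::euclidean_space"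
  by (force simp: lattice_points_def Basis_prod_def)

lemma of_int_vec_lattice: "of_int_vec y \<in> lattice_points"
  by (simp add: lattice_points_vec_iff of_int_vec_def)

lemma lattice_point_of_int_vec:
  fixes x :: "real ^ 'd"
  assumes "x \<in> lattice_points"
  shows "\<exists>y. x = of_int_vec y"
  using assms by (intro exI[of _ "\<chi> k. \<lfloor>x $ k\<rfloor>"])
    (auto simp: lattice_points_vec_iff of_int_vec_def vec_eq_iff of_int_floor)

lemma of_int_vec_inner: "of_int_vec u \<bullet> of_int_vec v = of_int (\<Sum>k\<in>UNIV. u $ k * v $ k)"
  by (simp add: inner_vec_def of_int_vec_def)

lemma primitiveI:
  assumes "v \<in> lattice_points"
    and "\<And>d::int. (\<And>e. e \<in> Basis \<Longrightarrow> d dvd \<lfloor>v \<bullet> e\<rfloor>) \<Longrightarrow> d dvd 1"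
  shows "primitive v"
proof -
  have "Gcd ((\<lambda>e. \<lfloor>v \<bullet> e\<rfloor>) ` Basis) dvd 1"
    by (rule assms(2)) (intro Gcd_dvd imageI)
  then show ?thesis using assms(1) by (simp add: primitive_def)
qed

lemma mem_dilate_iff: "c \<noteq> 0 \<Longrightarrow> x \<in> dilate c S \<longleftrightarrow> (1 / c) *\<^sub>R x \<in> S"
  by (force simp: dilate_def image_iff)

locale described_polytope =
  fixes P :: "(real ^ 'd) set" and a :: "nat \<Rightarrow> int ^ 'd" and b :: "nat \<Rightarrow> int"
    and n r m :: nat and W :: "(real ^ 'd) set"
  assumes P_eq: "P = {x. \<forall>j\<in>{1..n}. of_int_vec (a j) \<bullet> x \<le> of_int (b j)}"
    and full_dim: "aff_dim P = int CARD('d)"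
    and codenom: "r = codenominator n b"
    and zero: "0 \<in> P"
    and P_irredundant:
      "\<And>l. l \<in> {1..n} \<Longrightarrow> {x. \<forall>j\<in>{1..n} - {l}. of_int_vec (a j) \<bullet> x \<le> of_int (b j)} \<noteq> P"
    and gcd_rows: "\<And>j. j \<in> {1..n} \<Longrightarrow> Gcd (insert (b j) (range (\<lambda>k. a j $ k))) = 1"
    and m_pos: "m > 0"
    and W: "finite W" "W \<subseteq> lattice_points" "dilate (real m / real r) P = convex hull W"
begin

abbreviation "A j \<equiv> of_int_vec (a j)"

text \<open>The constraint \<open>a\<^sub>j \<bullet> x \<le> b\<^sub>j\<close> on \<open>P\<close>, homogenized over \<open>1/r P\<close> and divided by \<open>b\<^sub>j\<close> where possible.\<close>
definition normal :: "nat \<Rightarrow> real \<times> (real ^ 'd)" where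
  "normal j = (if b j = 0 then (0, - A j) else (1, - (real r / of_int (b j)) *\<^sub>R A j))"

definition normals :: "(real \<times> (real ^ 'd)) set" where
  "normals = normal ` {1..n}"

definition height_vector :: "real \<times> (real ^ 'd)" where
  "height_vector = (1, 0)"

lemma b_nonneg: "j \<in> {1..n} \<Longrightarrow> 0 \<le> b j"
  using zero unfolding P_eq by auto

lemma int_r: "int r = Lcm (b ` {1..n} - {0})"
  by (simp add: codenom codenominator_def)

lemma r_pos: "r > 0"
proof -
  have "Lcm (b ` {1..n} - {0}) \<noteq> 0" by (subst Lcm_0_iff) auto
  then show ?thesis using int_r by linarith
qed

lemma b_dvd_r: "j \<in> {1..n} \<Longrightarrow> b j \<noteq> 0 \<Longrightarrow> b j dvd int r"
  unfolding int_r by (rule dvd_Lcm) auto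

lemma convex_P: "convex P"
proof -
  have "P = (\<Inter>j\<in>{1..n}. {x. A j \<bullet> x \<le> of_int (b j)})" using P_eq by auto
  then show ?thesis by (simp only:) (intro convex_INT convex_halfspace_le)
qed

lemma bounded_P: "bounded P"
proof -
  have "P = dilate (real r / real m) (dilate (real m / real r) P)"
    using r_pos m_pos by (simp add: dilate_def image_image)
  moreover have "bounded (dilate (real r / real m) (convex hull W))"
    unfolding dilate_def by (intro bounded_scaling bounded_convex_hull finite_imp_bounded W)
  ultimately show ?thesis using W(3) by simp
qed

text \<open>The right-hand sides are nonnegative, so such an \<open>x\<close> would span a ray inside the bounded set \<open>P\<close>.\<close>
lemma no_recession:
  assumes "\<And>j. j \<in> {1..n} \<Longrightarrow> A j \<bullet> x \<le> 0"
  shows "x = 0"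
proof (rule ccontr)
  assume "x \<noteq> 0"
  obtain K where K: "\<And>y. y \<in> P \<Longrightarrow> norm y \<le> K" using bounded_P bounded_iff by blast
  have K0: "0 \<le> K" using K[OF zero] by simp
  let ?t = "(K + 1) / norm x"
  have "?t \<ge> 0" using K0 by simp
  have "?t *\<^sub>R x \<in> P"
    unfolding P_eq
  proof (intro CollectI ballI)
    fix j assume j: "j \<in> {1..n}"
    have "A j \<bullet> (?t *\<^sub>R x) \<le> 0"
      using assms[OF j] \<open>?t \<ge> 0\<close> by (simp only: inner_scaleR_right mult_nonneg_nonpos)
    also have "\<dots> \<le> of_int (b j)" using b_nonneg[OF j] by simp
    finally show "A j \<bullet> (?t *\<^sub>R x) \<le> of_int (b j)" .
  qed
  from K[OF this] show False using \<open>x \<noteq> 0\<close> K0 by simp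
qed

lemma exists_b_pos: "\<exists>j\<in>{1..n}. 0 < b j"
proof (rule ccontr)
  assume "\<not> ?thesis"
  then have "\<And>j. j \<in> {1..n} \<Longrightarrow> b j = 0" using b_nonneg by force
  then have "x = 0" if "x \<in> P" for x
    using that by (intro no_recession) (auto simp: P_eq)
  then have "P = {0}" using zero by blast
  then show False using full_dim by simp
qed

lemma A_nonzero:
  assumes "j \<in> {1..n}"
  shows "A j \<noteq> 0"
proof
  assume "A j = 0"
  then have "{x. \<forall>l\<in>{1..n} - {j}. A l \<bullet> x \<le> of_int (b l)} = P"
    unfolding P_eq using b_nonneg[OF assms] by fastforce
  then show False using P_irredundant[OF assms] by blast
qed

lemma interior_P: "interior P = {x. \<forall>j\<in>{1..n}. A j \<bullet> x < of_int (b j)}"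
proof
  have "open {x. \<forall>j\<in>{1..n}. A j \<bullet> x < of_int (b j)}"
    unfolding Collect_ball_eq by (intro open_INT ballI open_halfspace_lt) auto
  then show "{x. \<forall>j\<in>{1..n}. A j \<bullet> x < of_int (b j)} \<subseteq> interior P"
    by (rule interior_maximal[rotated]) (auto simp: P_eq intro: less_imp_le)
  show "interior P \<subseteq> {x. \<forall>j\<in>{1..n}. A j \<bullet> x < of_int (b j)}"
  proof (intro subsetI CollectI ballI)
    fix x j assume x: "x \<in> interior P" and j: "j \<in> {1..n}"
    have "interior P \<subseteq> interior {x. A j \<bullet> x \<le> of_int (b j)}"
      by (rule interior_mono) (use j in \<open>auto simp: P_eq\<close>)
    then show "A j \<bullet> x < of_int (b j)"
      using x A_nonzero[OF j] by (auto simp: interior_halfspace_le)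
  qed
qed

lemma interior_P_nonempty: "interior P \<noteq> {}"
proof -
  have "affine hull P = UNIV" using full_dim aff_dim_eq_full[of P] by simp
  then have "rel_interior P = interior P" by (rule rel_interior_interior)
  moreover have "rel_interior P \<noteq> {}" using rel_interior_eq_empty[OF convex_P] zero by blast
  ultimately show ?thesis by simp
qed

lemma normal_inner:
  "normal j \<bullet> (c, x) = (if b j = 0 then - (A j \<bullet> x) else c - real r / of_int (b j) * (A j \<bullet> x))"
  by (simp add: normal_def inner_prod_def)

lemma normal_nonneg_iff:
  assumes "j \<in> {1..n}"
  shows "0 \<le> normal j \<bullet> (c, x) \<longleftrightarrow> real r * (A j \<bullet> x) \<le> of_int (b j) * c"
proof (cases "b j = 0")
  case True
  then show ?thesis using r_pos by (simp add: normal_inner mult_le_0_iff)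
next
  case False
  then have "0 < b j" using b_nonneg[OF assms] by simp
  then show ?thesis by (simp add: normal_inner field_simps)
qed

lemma normal_pos_iff:
  assumes "j \<in> {1..n}"
  shows "0 < normal j \<bullet> (c, x) \<longleftrightarrow> real r * (A j \<bullet> x) < of_int (b j) * c"
proof (cases "b j = 0")
  case True
  then show ?thesis using r_pos by (simp add: normal_inner mult_less_0_iff)
next
  case False
  then have "0 < b j" using b_nonneg[OF assms] by simp
  then show ?thesis by (simp add: normal_inner field_simps)
qed

lemma normal_primitive:
  assumes j: "j \<in> {1..n}"
  shows "primitive (normal j)"
proof (rule primitiveI)
  show "normal j \<in> lattice_points"
  proof (cases "b j = 0")
    case True
    then show ?thesis
      by (simp add: normal_def lattice_points_Pair_iff lattice_points_vec_iff of_int_vec_def)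
  next
    case False
    have "real r / of_int (b j) = of_int (int r div b j)"
      using b_dvd_r[OF j False] by (metis of_int_of_nat_eq real_of_int_div)
    then show ?thesis
      using False by (simp add: normal_def lattice_points_Pair_iff lattice_points_vec_iff of_int_vec_def)
  qed
  fix d :: int assume d: "\<And>e. e \<in> Basis \<Longrightarrow> d dvd \<lfloor>normal j \<bullet> e\<rfloor>"
  show "d dvd 1"
  proof (cases "b j = 0")
    case False
    then show ?thesis using d[of "(1, 0)"] by (simp add: normal_def Basis_prod_def)
  next
    case True
    have "d dvd a j $ k" for k
    proof -
      have "(0, axis k 1) \<in> (Basis :: (real \<times> (real ^ 'd)) set)"
        by (auto simp: Basis_prod_def Basis_vec_def)
      then have "d dvd \<lfloor>normal j \<bullet> (0, axis k 1)\<rfloor>" by (rule d)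
      also have "normal j \<bullet> (0, axis k 1) = of_int (- (a j $ k))"
        using True by (simp add: normal_def inner_axis of_int_vec_def)
      finally show ?thesis by (simp only: floor_of_int dvd_minus_iff)
    qed
    then have "d dvd Gcd (insert (b j) (range (\<lambda>k. a j $ k)))"
      using True by (intro Gcd_greatest) auto
    then show ?thesis by (simp only: gcd_rows[OF j])
  qed
qed

sublocale facet_cone normals
proof
  show "primitive v" if "v \<in> normals" for v
    using that normal_primitive by (auto simp: normals_def)
  obtain x where "x \<in> interior P" using interior_P_nonempty by blast
  then have "\<And>j. j \<in> {1..n} \<Longrightarrow> 0 < normal j \<bullet> (real r, x)"
    using r_pos by (simp add: normal_pos_iff interior_P mult.commute[of "real r"])
  then show "\<exists>s. \<forall>v\<in>normals. 0 < v \<bullet> s" unfolding normals_def by blast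
  fix v assume "v \<in> normals"
  then obtain j where j: "j \<in> {1..n}" "v = normal j" unfolding normals_def by blast
  have "P \<subseteq> {x. \<forall>l\<in>{1..n} - {j}. A l \<bullet> x \<le> of_int (b l)}" by (auto simp: P_eq)
  then obtain x where x: "\<And>l. l \<in> {1..n} - {j} \<Longrightarrow> A l \<bullet> x \<le> of_int (b l)" "x \<notin> P"
    using P_irredundant[OF j(1)] by blast
  then have "\<not> A j \<bullet> x \<le> of_int (b j)" unfolding P_eq by blast
  then have "normal j \<bullet> (real r, x) < 0"
    using normal_nonneg_iff[OF j(1), of "real r" x] r_pos by (simp add: mult.commute[of "real r"] not_le)
  moreover have "0 \<le> normal l \<bullet> (real r, x)" if "l \<in> {1..n} - {j}" for l
    using x(1)[OF that] that r_pos by (simp add: normal_nonneg_iff mult.commute[of "real r"])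
  ultimately show "\<exists>x. v \<bullet> x < 0 \<and> (\<forall>w\<in>normals - {v}. 0 \<le> w \<bullet> x)"
    unfolding j(2) normals_def by blast
qed (simp add: normals_def)

sublocale homogeneous_generators "{real m} \<times> W" height_vector m
  using W m_pos by unfold_locales (auto simp: height_vector_def)

lemma mem_C_iff: "z \<in> C \<longleftrightarrow> (\<forall>j\<in>{1..n}. 0 \<le> normal j \<bullet> z)"
  unfolding C_def by (auto simp: normals_def)

lemma mem_Co_iff: "z \<in> Co \<longleftrightarrow> (\<forall>j\<in>{1..n}. 0 < normal j \<bullet> z)"
  unfolding Co_def by (auto simp: normals_def)

text \<open>At heights \<open>c \<le> 0\<close> the inequalities leave only the origin: \<open>b\<^sub>j c \<le> 0\<close> makes \<open>x\<close> a recession direction of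
  \<open>P\<close>, and some \<open>b\<^sub>j\<close> is positive.\<close>
lemma C_slices: "(c, x) \<in> C \<longleftrightarrow> 0 \<le> c \<and> x \<in> dilate (c / real r) P"
proof (cases "0 < c")
  case True
  then have "x \<in> dilate (c / real r) P \<longleftrightarrow> (real r / c) *\<^sub>R x \<in> P"
    using r_pos by (subst mem_dilate_iff) auto
  also have "\<dots> \<longleftrightarrow> (\<forall>j\<in>{1..n}. 0 \<le> normal j \<bullet> (c, x))"
    using True r_pos by (simp add: P_eq normal_nonneg_iff field_simps)
  finally show ?thesis using True by (simp add: mem_C_iff)
next
  case False
  have only: "x = 0 \<and> c = 0" if "(c, x) \<in> C"
  proof -
    have le: "real r * (A j \<bullet> x) \<le> of_int (b j) * c" if "j \<in> {1..n}" for j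
      using \<open>(c, x) \<in> C\<close> that by (auto simp: mem_C_iff simp flip: normal_nonneg_iff)
    have "A j \<bullet> x \<le> 0" if j: "j \<in> {1..n}" for j
    proof -
      have "of_int (b j) * c \<le> 0" using b_nonneg[OF j] False by (intro mult_nonneg_nonpos) auto
      then have "real r * (A j \<bullet> x) \<le> 0" using le[OF j] by linarith
      then show ?thesis using r_pos by (simp add: mult_le_0_iff)
    qed
    then have x: "x = 0" by (rule no_recession)
    obtain j where j: "j \<in> {1..n}" "0 < b j" using exists_b_pos by blast
    have "0 \<le> c" using le[OF j(1)] x j(2) by (simp add: zero_le_mult_iff)
    then show ?thesis using False x by simp
  qed
  have origin: "(0, 0) \<in> C" by (simp add: mem_C_iff normal_inner)
  have dilate_0: "dilate 0 P = {0}"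
    unfolding dilate_def scaleR_zero_left by (rule image_constant[OF zero])
  show ?thesis
  proof (cases "c = 0")
    case True
    have "(0, x) \<in> C \<longleftrightarrow> x = 0" using only origin True by metis
    then show ?thesis by (simp add: True dilate_0)
  next
    case c: False
    then have "(c, x) \<notin> C" using only by blast
    then show ?thesis using c False by simp
  qed
qed

lemma convex_hull_generators: "convex hull ({real m} \<times> W) = {real m} \<times> dilate (real m / real r) P"
  by (simp add: convex_hull_Times W(3))

lemma cone_U_eq_C: "cone_U = C"
proof (intro equalityI subsetI)
  fix z assume "z \<in> cone_U"
  then obtain c y where z: "z = c *\<^sub>R y" "0 \<le> c" "y \<in> {real m} \<times> dilate (real m / real r) P"
    unfolding cone_U_def convex_hull_generators by blast
  moreover from z(3) obtain x where "y = (real m, (real m / real r) *\<^sub>R x)" "x \<in> P"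
    unfolding dilate_def by blast
  ultimately show "z \<in> C" by (auto simp: C_slices dilate_def)
next
  fix z assume "z \<in> C"
  then obtain c x where z: "z = (c, (c / real r) *\<^sub>R x)" "0 \<le> c" "x \<in> P"
    by (cases z) (auto simp: C_slices dilate_def)
  then have "z = (c / real m) *\<^sub>R (real m, (real m / real r) *\<^sub>R x)"
    using m_pos by simp
  then show "z \<in> cone_U"
    unfolding cone_U_def convex_hull_generators dilate_def using z(2,3)
    by (intro CollectI exI[of _ "c / real m"] exI[of _ "(real m, (real m / real r) *\<^sub>R x)"])
      (auto intro!: imageI)
qed

sublocale graded_cone "{real m} \<times> W" normals height_vector m
proof
  show "cone_U = C" by (rule cone_U_eq_C)
  show "{real m} \<times> W \<subseteq> lattice_points" using W(2) by (auto simp: lattice_points_Pair_iff)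
  show "height_vector \<in> lattice_points"
    by (simp add: height_vector_def lattice_points_Pair_iff lattice_points_0)
  show "2 \<le> DIM(real \<times> (real ^ 'd))"
    using zero_less_card_finite[where 'a = 'd] by (simp add: Suc_le_eq)
qed

lemma homog_cone_eq: "homog_cone (dilate (1 / real r) P) = C"
proof -
  have convex: "convex hull ({1} \<times> dilate (1 / real r) P) = {1} \<times> dilate (1 / real r) P"
    unfolding dilate_def by (intro convex_hull_eq[THEN iffD2] convex_Times convex_scaling convex_P) simp
  have ne: "{1::real} \<times> dilate (1 / real r) P \<noteq> {}" using zero by (auto simp: dilate_def)
  show ?thesis
    unfolding homog_cone_def convex_cone_hull_convex_hull_nonempty[OF ne] convex
  proof (intro equalityI subsetI)
    fix z assume "z \<in> (\<Union>x\<in>{1::real} \<times> dilate (1 / real r) P. \<Union>c\<in>{0..}. {c *\<^sub>R x})"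
    then obtain c y where z: "0 \<le> c" "y \<in> {1::real} \<times> dilate (1 / real r) P" "z = c *\<^sub>R y" by auto
    moreover from z(2) obtain x where "y = (1, (1 / real r) *\<^sub>R x)" "x \<in> P"
      unfolding dilate_def by blast
    ultimately show "z \<in> C" by (auto simp: C_slices dilate_def)
  next
    fix z assume "z \<in> C"
    then obtain c x where z: "z = (c, (c / real r) *\<^sub>R x)" "0 \<le> c" "x \<in> P"
      by (cases z) (auto simp: C_slices dilate_def)
    then have "z = c *\<^sub>R (1, (1 / real r) *\<^sub>R x)" by simp
    moreover have "(1, (1 / real r) *\<^sub>R x) \<in> {1::real} \<times> dilate (1 / real r) P"
      unfolding dilate_def using z by (intro SigmaI imageI) auto
    ultimately show "z \<in> (\<Union>x\<in>{1::real} \<times> dilate (1 / real r) P. \<Union>c\<in>{0..}. {c *\<^sub>R x})"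
      using z(2) by (intro UN_I[of "(1, (1 / real r) *\<^sub>R x)"] UN_I[of c]) auto
  qed
qed

lemma Co_slices: "0 < c \<Longrightarrow> (c, x) \<in> Co \<longleftrightarrow> x \<in> dilate (c / real r) (interior P)"
proof -
  assume c: "0 < c"
  then have "x \<in> dilate (c / real r) (interior P) \<longleftrightarrow> (real r / c) *\<^sub>R x \<in> interior P"
    using r_pos by (subst mem_dilate_iff) auto
  also have "\<dots> \<longleftrightarrow> (\<forall>j\<in>{1..n}. 0 < normal j \<bullet> (c, x))"
    using c r_pos by (simp add: interior_P normal_pos_iff field_simps)
  finally show ?thesis by (simp add: mem_Co_iff)
qed

lemma card_slice_eq_ehr: "card (slice k) = ehr P (real k / real r)"
proof -
  have "slice k = Pair (real k) ` (dilate (real k / real r) P \<inter> lattice_points)"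
    by (auto simp: height_vector_def C_slices lattice_points_Pair_iff)
  then show ?thesis by (simp add: ehr_def card_image inj_on_def)
qed

lemma card_open_slice_eq_ehr:
  assumes "k > 0"
  shows "card (open_slice k) = ehr (interior P) (real k / real r)"
proof -
  have "open_slice k = Pair (real k) ` (dilate (real k / real r) (interior P) \<inter> lattice_points)"
    using assms by (auto simp: height_vector_def Co_slices lattice_points_Pair_iff)
  then show ?thesis by (simp add: ehr_def card_image inj_on_def)
qed

lemma Ehr_fps_eq: "Ehr_fps P r = height_series height_vector (C \<inter> lattice_points)"
proof (rule fps_ext)
  fix k
  show "fps_nth (Ehr_fps P r) k = fps_nth (height_series height_vector (C \<inter> lattice_points)) k"
    using card_slice_eq_ehr[of k] slice_0 by (cases "k = 0") (simp_all add: Ehr_fps_def)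
qed

lemma normals_eq_1_iff:
  assumes i: "i \<le> n" "\<And>j. j \<in> {1..i} \<Longrightarrow> b j = 0" "\<And>j. j \<in> {i+1..n} \<Longrightarrow> b j \<noteq> 0"
  shows "(\<forall>v\<in>normals. v \<bullet> (of_int g, of_int_vec y) = 1)
    \<longleftrightarrow> facet_system_solution a b i n r g y"
proof -
  let ?s = "\<lambda>j. \<Sum>k\<in>UNIV. a j $ k * y $ k"
  have zero: "normal j \<bullet> (of_int g, of_int_vec y) = 1 \<longleftrightarrow> - ?s j = 1" if "j \<in> {1..i}" for j
  proof -
    have "normal j \<bullet> (of_int g, of_int_vec y) = of_int (- ?s j)"
      using i(2)[OF that] by (simp add: normal_inner of_int_vec_inner)
    then show ?thesis by (simp only: of_int_eq_1_iff)
  qed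
  have nonzero: "normal j \<bullet> (of_int g, of_int_vec y) = 1 \<longleftrightarrow> b j * g - int r * ?s j = b j"
    if j: "j \<in> {i+1..n}" for j
  proof -
    have "normal j \<bullet> (of_int g, of_int_vec y) = 1
        \<longleftrightarrow> (of_int (b j * g - int r * ?s j) :: real) = of_int (b j)"
    proof -
      have "c - \<rho> / \<beta> * s = 1 \<longleftrightarrow> \<beta> * c - \<rho> * s = \<beta>" if "\<beta> \<noteq> 0" for c \<rho> \<beta> s :: real
        using that by (auto simp: field_simps)
      from this[of "of_int (b j)"] show ?thesis
        using i(3)[OF j] unfolding normal_inner of_int_vec_inner by simp
    qed
    then show ?thesis by (simp only: of_int_eq_iff)
  qed
  have "{1..n} = {1..i} \<union> {i+1..n}" using i(1) by auto
  then show ?thesis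
    unfolding facet_system_solution_def normals_def using zero nonzero by auto
qed

lemma lattice_point_of_height:
  assumes "p \<in> lattice_points" "height_vector \<bullet> p = real g"
  obtains y where "p = (real g, of_int_vec y)"
proof -
  obtain c x where p: "p = (c, x)" by (cases p)
  then have "c = real g" using assms(2) by (simp add: height_vector_def)
  moreover obtain y where "x = of_int_vec y"
    using assms(1) p lattice_point_of_int_vec by (auto simp: lattice_points_Pair_iff)
  ultimately show ?thesis using p that by simp
qed

lemma point_lattice: "(real g, of_int_vec y) \<in> lattice_points"
  by (simp add: lattice_points_Pair_iff of_int_vec_lattice)

lemma point_height: "height_vector \<bullet> (real g, of_int_vec y) = real g"
  by (simp add: height_vector_def)

lemma equal_ehr_iff_equal_counts:
  assumes "g > 0"
  shows "(\<forall>k. ehr P (real k / real r) = ehr (interior P) (real (k + g) / real r))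
    \<longleftrightarrow> (\<forall>k. card (slice k) = card (open_slice (k + g)))"
proof -
  have "card (open_slice (k + g)) = ehr (interior P) (real (k + g) / real r)" for k
    by (rule card_open_slice_eq_ehr) (use assms in simp)
  then show ?thesis by (simp only: card_slice_eq_ehr)
qed

lemma equal_ehr_iff:
  assumes "g > 0"
  shows "(\<forall>k. ehr P (real k / real r) = ehr (interior P) (real (k + g) / real r))
    \<longleftrightarrow> (\<exists>y. \<forall>v\<in>normals. v \<bullet> (real g, of_int_vec y) = 1)"
  unfolding equal_ehr_iff_equal_counts[OF assms]
proof
  assume counts: "\<forall>k. card (slice k) = card (open_slice (k + g))"
  obtain p where p: "p \<in> lattice_points" "height_vector \<bullet> p = real g"
      "Co \<inter> lattice_points = (+) p ` (C \<inter> lattice_points)"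
    by (rule equal_counts_imp_translate[OF spec[OF counts]])
  obtain y where y: "p = (real g, of_int_vec y)"
    by (rule lattice_point_of_height[OF p(1,2)])
  have "\<forall>v\<in>normals. v \<bullet> p = 1"
    using translate_eq_interior_iff[OF p(1)] p(3) by (rule iffD1)
  then show "\<exists>y. \<forall>v\<in>normals. v \<bullet> (real g, of_int_vec y) = 1"
    unfolding y by (rule exI)
next
  assume "\<exists>y. \<forall>v\<in>normals. v \<bullet> (real g, of_int_vec y) = 1"
  then obtain y where "\<forall>v\<in>normals. v \<bullet> (real g, of_int_vec y) = 1" by blast
  then have "Co \<inter> lattice_points = (+) (real g, of_int_vec y) ` (C \<inter> lattice_points)"
    using translate_eq_interior_iff[OF point_lattice] by blast
  from translate_imp_series[OF point_lattice point_height this]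
  have "fps_nth (fps_X ^ g * height_series height_vector (C \<inter> lattice_points)) (k + g)
      = fps_nth (height_series height_vector (Co \<inter> lattice_points)) (k + g)" for k
    by simp
  then show "\<forall>k. card (slice k) = card (open_slice (k + g))"
    by (simp only: fps_X_power_mult_nth height_series_nth) simp
qed

lemma shifted_series_iff:
  assumes "g > 0"
  shows "fps_X ^ g * height_series height_vector (C \<inter> lattice_points)
      = height_series height_vector (Co \<inter> lattice_points)
    \<longleftrightarrow> (\<exists>y. \<forall>v\<in>normals. v \<bullet> (real g, of_int_vec y) = 1)"
proof
  assume eq: "fps_X ^ g * height_series height_vector (C \<inter> lattice_points)
      = height_series height_vector (Co \<inter> lattice_points)"
  have "card (slice k) = card (open_slice (k + g))" for k
    using arg_cong[OF eq, of "\<lambda>F. fps_nth F (k + g)"]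
    by (simp only: fps_X_power_mult_nth height_series_nth) simp
  then show "\<exists>y. \<forall>v\<in>normals. v \<bullet> (real g, of_int_vec y) = 1"
    using equal_ehr_iff[OF assms] equal_ehr_iff_equal_counts[OF assms] by blast
next
  assume "\<exists>y. \<forall>v\<in>normals. v \<bullet> (real g, of_int_vec y) = 1"
  then obtain y where "\<forall>v\<in>normals. v \<bullet> (real g, of_int_vec y) = 1" by blast
  then have "Co \<inter> lattice_points = (+) (real g, of_int_vec y) ` (C \<inter> lattice_points)"
    using translate_eq_interior_iff[OF point_lattice] by blast
  then show "fps_X ^ g * height_series height_vector (C \<inter> lattice_points)
      = height_series height_vector (Co \<inter> lattice_points)"
    by (rule translate_imp_series[OF point_lattice point_height])
qed

lemma rational_Gorenstein_iff:
  "(real g, of_int_vec y) \<in> homog_cone (dilate (1 / real r) P)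
      \<and> rational_Gorenstein (real r) P (real g, of_int_vec y)
    \<longleftrightarrow> (\<forall>v\<in>normals. v \<bullet> (real g, of_int_vec y) = 1)"
  unfolding rational_Gorenstein_def homog_cone_eq gorenstein_iff[OF point_lattice]
  by (auto simp: C_def)

lemma dual_cone_condition_iff:
  "(real g, of_int_vec y) \<in> interior (homog_cone (dilate (1 / real r) P))
      \<and> (\<forall>v. primitive_ray_generator (dual_cone (homog_cone (dilate (1 / real r) P))) v \<longrightarrow>
             (real g, of_int_vec y) \<bullet> v = 1)
    \<longleftrightarrow> (\<forall>v\<in>normals. v \<bullet> (real g, of_int_vec y) = 1)"
  unfolding homog_cone_eq primitive_ray_generator_dual_iff interior_C
  by (auto simp: Co_def inner_commute)

text \<open>Reciprocity also shows that the defining series of \<open>hstar\<close> is a polynomial.\<close>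
lemma reciprocal_numerators_hstar:
  obtains h' where "reciprocal_numerators (Ehr_fps P r)
    (height_series height_vector (Co \<inter> lattice_points)) (hstar P r m) h' m (CARD('d) + 1)"
proof -
  have ne: "{x. \<forall>v\<in>normals. 0 < v \<bullet> x} \<noteq> {}" using interior_point by blast
  have cone: "cone_U = {x. \<forall>v\<in>normals. 0 \<le> v \<bullet> x}" by (simp add: cone_U_eq C_def)
  have dim: "DIM(real \<times> (real ^ 'd)) = CARD('d) + 1" by simp
  obtain h h' :: "int poly" where h:
    "fps_of_poly h = (1 - fps_X ^ m) ^ (CARD('d) + 1) * Ehr_fps P r"
    "fps_of_poly h' = (1 - fps_X ^ m) ^ (CARD('d) + 1) *
       height_series height_vector (Co \<inter> lattice_points)"
    "degree h \<le> (CARD('d) + 1) * m" "degree h' \<le> (CARD('d) + 1) * m"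
    "\<And>k. k \<le> (CARD('d) + 1) * m \<Longrightarrow> coeff h' k = coeff h ((CARD('d) + 1) * m - k)"
    using reciprocity[OF U_lattice finite_V cone ne]
    unfolding cone_U_eq Ehr_fps_eq[symmetric] Co_def[symmetric] dim by metis
  have "hstar P r m = h"
    unfolding hstar_def h(1)[symmetric] by (simp add: fps_of_poly_eq_iff)
  then have "reciprocal_numerators (Ehr_fps P r)
    (height_series height_vector (Co \<inter> lattice_points)) (hstar P r m) h' m (CARD('d) + 1)"
    using h m_pos by unfold_locales auto
  then show ?thesis by (rule that)
qed

end

lemma all_equivalentI: "(\<And>p. p \<in> set Ps \<Longrightarrow> p \<longleftrightarrow> Q) \<Longrightarrow> all_equivalent Ps"
  by (auto simp: all_equivalent_def)

theorem theorem27: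
  fixes P :: "(real ^ 'd) set"
    and a :: "nat \<Rightarrow> int ^ 'd" and b :: "nat \<Rightarrow> int"
    and n i r g m :: nat
  assumes P_eq: "P = {x. \<forall>j\<in>{1..n}. of_int_vec (a j) \<bullet> x \<le> of_int (b j)}"
    and rational: "rational_polytope P"
    and full_dim: "aff_dim P = int CARD('d)"
    and codenom: "r = codenominator n b"
    and zero: "0 \<in> P"
    and irredundant:
      "\<And>l. l \<in> {1..n} \<Longrightarrow> {x. \<forall>j\<in>{1..n} - {l}. of_int_vec (a j) \<bullet> x \<le> of_int (b j)} \<noteq> P"
    and gcd_rows: "\<And>j. j \<in> {1..n} \<Longrightarrow> Gcd (insert (b j) (range (\<lambda>k. a j $ k))) = 1"
    and i_le: "i \<le> n"
    and b_zero: "\<And>j. j \<in> {1..i} \<Longrightarrow> b j = 0"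
    and b_nonzero: "\<And>j. j \<in> {i+1..n} \<Longrightarrow> b j \<noteq> 0"
    and g_pos: "g \<ge> 1"
    and m_pos: "m \<ge> 1"
    and lattice: "lattice_polytope (dilate (real m / real r) P)"
  shows "all_equivalent
    [ \<exists>y :: int ^ 'd.
        (real g, of_int_vec y) \<in> homog_cone (dilate (1 / real r) P) \<and>
        rational_Gorenstein (real r) P (real g, of_int_vec y),

      \<exists>y :: int ^ 'd. facet_system_solution a b i n r (int g) y,

      ratfun_X powi (int ((CARD('d) + 1) * m) - int g) * at_recip (to_fract (hstar P r m))
        = to_fract (hstar P r m),

      (- 1) ^ (CARD('d) + 1) * ratfun_X ^ g * Ehr P r = at_recip (Ehr P r),

      \<forall>k :: nat. ehr P (real k / real r) = ehr (interior P) (real (k + g) / real r),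

      \<exists>y :: int ^ 'd.
        (real g, of_int_vec y) \<in> interior (homog_cone (dilate (1 / real r) P)) \<and>
        (\<forall>v. primitive_ray_generator (dual_cone (homog_cone (dilate (1 / real r) P))) v \<longrightarrow>
             (real g, of_int_vec y) \<bullet> v = 1) ]
    \<and> (\<forall>g' y g'' y'. facet_system_solution a b i n r g' y \<and> facet_system_solution a b i n r g'' y'
          \<longrightarrow> g' = g'' \<and> y = y')"
proof
  obtain W where W: "finite W" "W \<subseteq> lattice_points" "dilate (real m / real r) P = convex hull W"
    using lattice by (auto simp: lattice_polytope_def)
  interpret described_polytope P a b n r m W
    using P_eq full_dim codenom zero irredundant gcd_rows m_pos W by unfold_locales auto
  obtain h' where "reciprocal_numerators (Ehr_fps P r)
      (height_series height_vector (Co \<inter> lattice_points)) (hstar P r m) h' m (CARD('d) + 1)"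
    by (rule reciprocal_numerators_hstar)
  then interpret reciprocal_numerators "Ehr_fps P r"
      "height_series height_vector (Co \<inter> lattice_points)" "hstar P r m" h' m "CARD('d) + 1" .
  have g: "g > 0" using g_pos by simp
  note system = normals_eq_1_iff[OF i_le b_zero b_nonzero]
  show "all_equivalent
    [ \<exists>y :: int ^ 'd.
        (real g, of_int_vec y) \<in> homog_cone (dilate (1 / real r) P) \<and>
        rational_Gorenstein (real r) P (real g, of_int_vec y),

      \<exists>y :: int ^ 'd. facet_system_solution a b i n r (int g) y,

      ratfun_X powi (int ((CARD('d) + 1) * m) - int g) * at_recip (to_fract (hstar P r m))
        = to_fract (hstar P r m),

      (- 1) ^ (CARD('d) + 1) * ratfun_X ^ g * Ehr P r = at_recip (Ehr P r),

      \<forall>k :: nat. ehr P (real k / real r) = ehr (interior P) (real (k + g) / real r),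

      \<exists>y :: int ^ 'd.
        (real g, of_int_vec y) \<in> interior (homog_cone (dilate (1 / real r) P)) \<and>
        (\<forall>v. primitive_ray_generator (dual_cone (homog_cone (dilate (1 / real r) P))) v \<longrightarrow>
             (real g, of_int_vec y) \<bullet> v = 1) ]" (is "all_equivalent [?i, ?ii, ?iii, ?iv, ?v, ?vi]")
  proof (rule all_equivalentI)
    let ?Q = "\<exists>y. \<forall>v\<in>normals. v \<bullet> (real g, of_int_vec y) = 1"
    have i: "?i \<longleftrightarrow> ?Q" by (simp only: rational_Gorenstein_iff)
    have "facet_system_solution a b i n r (int g) y
        \<longleftrightarrow> (\<forall>v\<in>normals. v \<bullet> (real g, of_int_vec y) = 1)" for y
      using system[where g = "int g" and y = y] by (simp only: of_int_of_nat_eq)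
    then have ii: "?ii \<longleftrightarrow> ?Q" by (simp only:)
    have iii: "?iii \<longleftrightarrow> ?Q"
      unfolding numerator_palindromic_iff Ehr_fps_eq by (rule shifted_series_iff[OF g])
    have iv: "?iv \<longleftrightarrow> ?Q"
      unfolding Ehr_def ratfun_reciprocal_iff unfolding Ehr_fps_eq by (rule shifted_series_iff[OF g])
    have v: "?v \<longleftrightarrow> ?Q" by (rule equal_ehr_iff[OF g])
    have vi: "?vi \<longleftrightarrow> ?Q" by (simp only: dual_cone_condition_iff)
    show "p \<longleftrightarrow> ?Q" if "p \<in> set [?i, ?ii, ?iii, ?iv, ?v, ?vi]" for p
      using that i ii iii iv v vi by (simp only: list.set insert_iff empty_iff) metis
  qed
  show "\<forall>g' y g'' y'. facet_system_solution a b i n r g' y \<and> facet_system_solution a b i n r g'' y'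
          \<longrightarrow> g' = g'' \<and> y = y'"
  proof (intro allI impI)
    fix g' g'' and y y' :: "int ^ 'd"
    assume "facet_system_solution a b i n r g' y \<and> facet_system_solution a b i n r g'' y'"
    then have "\<forall>v\<in>normals. v \<bullet> (of_int g', of_int_vec y) = 1"
        "\<forall>v\<in>normals. v \<bullet> (of_int g'', of_int_vec y') = 1"
      using system[where g = g' and y = y] system[where g = g'' and y = y'] by blast+
    then have "v \<bullet> (of_int g', of_int_vec y) = v \<bullet> (of_int g'', of_int_vec y')" if "v \<in> normals" for v
      using that by simp
    then have "(of_int g' :: real, of_int_vec y) = (of_int g'', of_int_vec y')"
      by (rule normals_separate)
    then show "g' = g'' \<and> y = y'" by (simp add: of_int_vec_def vec_eq_iff)
  qed
qed

end
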